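(* Let $C_n$ be the cycle with vertices $v_0,v_1,\dots,v_{n-1}$ (in cyclic order), and let $C_n^+$ be a graph obtained from $C_n$ by adding some edges from the set $E_0=\{v_iv_j: i+j=\nu\}$, where $\nu=n$ if $n$ is odd and $\nu\in\{n,n-1\}$ if $n$ is even. Then $\alpha(F_k(C_n^+))=\alpha(C_n^+)$ for $k=1,2$.
   Context: $\alpha(G)$ denotes the algebraic connectivity of $G$, i.e. the second smallest eigenvalue of its Laplacian matrix. For a graph $G=(V,E)$ on $n$ vertices and $1\le k\le n-1$, the $k$-token graph $F_k(G)$ has as vertices the $k$-subsets of $V$, two $k$-subsets being adjacent iff their symmetric difference is $\{a,b\}$ with $ab\in E$. *)

theory Defs
  imports "Jordan_Normal_Form.Char_Poly"
begin

type_synonym 'a graph = "'a set \<times> 'a set set"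

abbreviation verts :: "'a graph \<Rightarrow> 'a set" where "verts \<equiv> fst"

abbreviation edges :: "'a graph \<Rightarrow> 'a set set" where "edges \<equiv> snd"

definition vertex_degree :: "'a graph \<Rightarrow> 'a \<Rightarrow> nat" where
  "vertex_degree G u = card {v \<in> verts G. {u, v} \<in> edges G}"

text \<open>A matrix needs an ordering of the vertices; a different ordering gives a
  permutation-similar matrix, so the spectrum does not depend on the choice.\<close>

definition vertex_list :: "'a graph \<Rightarrow> 'a list" where
  "vertex_list G = (SOME vs. distinct vs \<and> set vs = verts G)"

definition laplacian_matrix :: "'a graph \<Rightarrow> real mat" where
  "laplacian_matrix G =
    (let vs = vertex_list G; n = length vs in
     mat n n (\<lambda>(i, j).
       if i = j then real (vertex_degree G (vs ! i))
       else if {vs ! i, vs ! j} \<in> edges G then -1 else 0))"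

text \<open>The eigenvalues are listed in increasing order and repeated according to multiplicity;
  list indices start at 0, so the second smallest one has index 1.\<close>

definition algebraic_connectivity :: "'a graph \<Rightarrow> real" where
  "algebraic_connectivity G =
    sorted_list_of_multiset (proots (char_poly (laplacian_matrix G))) ! 1"

definition token_graph :: "nat \<Rightarrow> 'a graph \<Rightarrow> 'a set graph" where
  "token_graph k G =
    (let W = {A. A \<subseteq> verts G \<and> finite A \<and> card A = k} in
     (W, {{A, B} | A B. A \<in> W \<and> B \<in> W \<and>
           (\<exists>a b. {a, b} \<in> edges G \<and> sym_diff A B = {a, b})}))"

definition cycle_graph :: "nat \<Rightarrow> nat graph" where
  "cycle_graph n = ({..<n}, {{i, (i + 1) mod n} | i. i < n})"

definition add_edges :: "'a graph \<Rightarrow> 'a set set \<Rightarrow> 'a graph" where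
  "add_edges G S = (verts G, edges G \<union> S)"

text \<open>The condition \<open>i \<noteq> j\<close> excludes the loop at \<open>\<nu> / 2\<close> for even \<open>\<nu>\<close>.\<close>

definition sum_edges :: "nat \<Rightarrow> nat \<Rightarrow> nat set set" where
  "sum_edges n \<nu> = {{i, j} | i j. i < n \<and> j < n \<and> i \<noteq> j \<and> i + j = \<nu>}"

end

theory Submission
  imports Defs "HOL-Analysis.Inner_Product" "HOL-Library.Real_Mod" "HOL-Number_Theory.Cong"
begin

text \<open>
  Both algebraic connectivities equal \<open>l = 2 - 2 * cos (2 * pi / n)\<close>. The eigenvalue \<open>l\<close> of
  the cycle has an eigenfunction that is symmetric under \<open>i \<mapsto> \<nu> - i\<close>; the added edges do not see
  it, so it survives in \<open>C\<^sub>n\<^sup>+\<close>, and summing it over the tokens gives an eigenfunction of the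
  token graph. Since adding edges only increases the Dirichlet form, it remains to prove the
  Poincare inequality with constant \<open>l\<close> on \<open>C\<^sub>n\<close> and on \<open>F\<^sub>2(C\<^sub>n)\<close>. On \<open>C\<^sub>n\<close> this is
  Parseval's identity. On \<open>F\<^sub>2(C\<^sub>n)\<close> a Fourier transform in the centre of mass of the two tokens
  leaves, for each mode \<open>r\<close>, a quadratic form on a path in the distance \<open>d\<close> of the tokens: mode \<open>0\<close>
  reduces to a cycle of length \<open>n - 1\<close>, modes \<open>1\<close> and \<open>n - 1\<close> have, up to signs, the ground state
  \<open>cos (pi * d / n)\<close> with eigenvalue exactly \<open>l\<close>, and all others are bounded below by
  \<open>2 - 2 * \<bar>cos (pi * r / n)\<bar> \<ge> l\<close>.
\<close>

section \<open>Algebraic connectivity and the Poincare inequality\<close>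

definition graph_laplacian :: "'a graph \<Rightarrow> ('a \<Rightarrow> real) \<Rightarrow> 'a \<Rightarrow> real" where
  "graph_laplacian G f u = (\<Sum>v | v \<in> verts G \<and> {u, v} \<in> edges G. f u - f v)"

definition dirichlet_form :: "'a graph \<Rightarrow> ('a \<Rightarrow> real) \<Rightarrow> real" where
  "dirichlet_form G f =
    (\<Sum>u\<in>verts G. \<Sum>v | v \<in> verts G \<and> {u, v} \<in> edges G. (f u - f v)\<^sup>2) / 2"

definition laplacian_eigenfunction :: "'a graph \<Rightarrow> real \<Rightarrow> ('a \<Rightarrow> real) \<Rightarrow> bool" where
  "laplacian_eigenfunction G \<mu> f \<longleftrightarrow>
    (\<forall>u\<in>verts G. graph_laplacian G f u = \<mu> * f u) \<and> (\<exists>u\<in>verts G. f u \<noteq> 0)"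

definition poincare_inequality :: "'a graph \<Rightarrow> real \<Rightarrow> bool" where
  "poincare_inequality G l \<longleftrightarrow>
    (\<forall>f. (\<Sum>u\<in>verts G. f u) = 0 \<longrightarrow> l * (\<Sum>u\<in>verts G. (f u)\<^sup>2) \<le> dirichlet_form G f)"

locale simple_graph =
  fixes G :: "'a graph"
  assumes finite_verts: "finite (verts G)"
    and no_loops: "{u} \<notin> edges G"

lemma sum_adjacent_swap:
  fixes \<phi> :: "'a \<Rightarrow> 'a \<Rightarrow> 'b :: comm_monoid_add"
  assumes "finite V"
  shows "(\<Sum>u\<in>V. \<Sum>v | v \<in> V \<and> {u, v} \<in> E. \<phi> u v) = (\<Sum>u\<in>V. \<Sum>v | v \<in> V \<and> {u, v} \<in> E. \<phi> v u)"
proof -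
  have "(\<Sum>u\<in>V. \<Sum>v | v \<in> V \<and> {u, v} \<in> E. \<phi> u v) = (\<Sum>v\<in>V. \<Sum>u | u \<in> V \<and> {u, v} \<in> E. \<phi> u v)"
    using assms by (rule sum.swap_restrict) (rule assms)
  then show ?thesis by (simp add: insert_commute)
qed

lemma sum_graph_laplacian:
  assumes "finite (verts G)"
  shows "(\<Sum>u\<in>verts G. graph_laplacian G f u) = 0"
proof -
  have "(\<Sum>u\<in>verts G. graph_laplacian G f u) = - (\<Sum>u\<in>verts G. graph_laplacian G f u)"
    unfolding graph_laplacian_def
    by (subst sum_adjacent_swap[OF assms]) (simp flip: sum_negf)
  then show ?thesis by simp
qed

lemma sum_mult_graph_laplacian:
  assumes "finite (verts G)"
  shows "(\<Sum>u\<in>verts G. f u * graph_laplacian G f u) = dirichlet_form G f"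
proof -
  let ?S = "\<Sum>u\<in>verts G. f u * graph_laplacian G f u"
  have expand: "?S = (\<Sum>u\<in>verts G. \<Sum>v | v \<in> verts G \<and> {u, v} \<in> edges G. f u * (f u - f v))"
    by (simp add: graph_laplacian_def sum_distrib_left)
  also have "\<dots> = (\<Sum>u\<in>verts G. \<Sum>v | v \<in> verts G \<and> {u, v} \<in> edges G. f v * (f v - f u))"
    by (rule sum_adjacent_swap[OF assms])
  finally have "2 * ?S = (\<Sum>u\<in>verts G. \<Sum>v | v \<in> verts G \<and> {u, v} \<in> edges G.
      f u * (f u - f v) + f v * (f v - f u))" using expand by (simp add: sum.distrib)
  also have "\<dots> = 2 * dirichlet_form G f"
    by (simp add: dirichlet_form_def power2_eq_square algebra_simps)
  finally show ?thesis by simp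
qed

lemma poincare_inequality_le_eigenvalue:
  assumes fin: "finite (verts G)" and poincare: "poincare_inequality G l"
    and eigen: "laplacian_eigenfunction G \<mu> f" and "\<mu> \<noteq> 0"
  shows "l \<le> \<mu>"
proof -
  let ?N = "\<Sum>u\<in>verts G. (f u)\<^sup>2"
  have lap: "graph_laplacian G f u = \<mu> * f u" if "u \<in> verts G" for u
    using eigen that by (simp add: laplacian_eigenfunction_def)
  have "\<mu> * (\<Sum>u\<in>verts G. f u) = (\<Sum>u\<in>verts G. graph_laplacian G f u)"
    by (simp add: lap sum_distrib_left)
  then have "(\<Sum>u\<in>verts G. f u) = 0" using \<open>\<mu> \<noteq> 0\<close> sum_graph_laplacian[OF fin, of f] by simp
  then have "l * ?N \<le> dirichlet_form G f" using poincare by (simp add: poincare_inequality_def)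
  also have "\<dots> = \<mu> * ?N"
    by (simp add: lap power2_eq_square sum_distrib_left mult_ac
        flip: sum_mult_graph_laplacian[OF fin])
  finally have "l * ?N \<le> \<mu> * ?N" .
  moreover have "0 < ?N"
    using fin eigen by (auto simp: laplacian_eigenfunction_def intro: sum_pos2)
  ultimately show ?thesis by simp
qed

lemma poincare_inequality_harmonic_constant:
  assumes fin: "finite (verts G)" and poincare: "poincare_inequality G l" and "0 < l"
    and harmonic: "\<And>u. u \<in> verts G \<Longrightarrow> graph_laplacian G f u = 0"
  shows "\<exists>a. \<forall>u\<in>verts G. f u = a"
proof (cases "verts G = {}")
  case False
  define a where "a = (\<Sum>u\<in>verts G. f u) / card (verts G)"
  have "(\<Sum>u\<in>verts G. f u - a) = 0" using fin False by (simp add: a_def sum_subtractf)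
  then have "l * (\<Sum>u\<in>verts G. (f u - a)\<^sup>2) \<le> dirichlet_form G (\<lambda>u. f u - a)"
    using poincare unfolding poincare_inequality_def by blast
  also have "\<dots> = dirichlet_form G f" by (simp add: dirichlet_form_def)
  also have "\<dots> = 0" by (simp add: harmonic flip: sum_mult_graph_laplacian[OF fin])
  finally have "(\<Sum>u\<in>verts G. (f u - a)\<^sup>2) \<le> 0" using \<open>0 < l\<close> by (simp add: mult_le_0_iff)
  then have "(\<Sum>u\<in>verts G. (f u - a)\<^sup>2) = 0" by (intro antisym sum_nonneg) auto
  then show ?thesis using fin by (auto simp: sum_nonneg_eq_0_iff)
qed simp

definition vertex_vec :: "'a graph \<Rightarrow> ('a \<Rightarrow> real) \<Rightarrow> real vec" where
  "vertex_vec G f = vec (card (verts G)) (\<lambda>i. f (vertex_list G ! i))"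

lemma dim_vertex_vec [simp]: "dim_vec (vertex_vec G f) = card (verts G)"
  by (simp add: vertex_vec_def)

lemma vertex_vec_carrier [simp]: "vertex_vec G f \<in> carrier_vec (card (verts G))"
  by (simp add: vertex_vec_def)

context simple_graph
begin

lemma vertex_list: "distinct (vertex_list G)" "set (vertex_list G) = verts G"
proof -
  have "\<exists>vs. distinct vs \<and> set vs = verts G" using finite_distinct_list[OF finite_verts] by blast
  from someI_ex[OF this] show "distinct (vertex_list G)" "set (vertex_list G) = verts G"
    unfolding vertex_list_def by auto
qed

lemma length_vertex_list [simp]: "length (vertex_list G) = card (verts G)"
  using vertex_list distinct_card by metis

lemma bij_betw_vertex_list: "bij_betw ((!) (vertex_list G)) {..<card (verts G)} (verts G)"
  using vertex_list by (intro bij_betw_nth) auto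

lemma sum_vertex_list: "(\<Sum>i<card (verts G). \<phi> (vertex_list G ! i)) = (\<Sum>v\<in>verts G. \<phi> v)"
  by (rule sum.reindex_bij_betw[OF bij_betw_vertex_list])

lemma vertex_vec_eq_iff: "vertex_vec G f = vertex_vec G g \<longleftrightarrow> (\<forall>u\<in>verts G. f u = g u)"
proof -
  have "vertex_vec G f = vertex_vec G g \<longleftrightarrow>
      (\<forall>u\<in>(!) (vertex_list G) ` {..<card (verts G)}. f u = g u)"
    by (auto simp: vertex_vec_def vec_eq_iff)
  then show ?thesis unfolding bij_betw_imp_surj_on[OF bij_betw_vertex_list] .
qed

lemma vertex_vec_surj:
  assumes "v \<in> carrier_vec (card (verts G))"
  obtains f where "v = vertex_vec G f"
proof
  let ?i = "the_inv_into {..<card (verts G)} ((!) (vertex_list G))"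
  show "v = vertex_vec G (\<lambda>u. v $ ?i u)"
    using assms bij_betw_vertex_list
    by (intro eq_vecI) (auto simp: vertex_vec_def bij_betw_def the_inv_into_f_f)
qed

lemma laplacian_matrix_carrier [simp]:
  "laplacian_matrix G \<in> carrier_mat (card (verts G)) (card (verts G))"
  by (simp add: laplacian_matrix_def Let_def)

lemma laplacian_matrix_entry:
  assumes "i < card (verts G)" "j < card (verts G)"
  shows "laplacian_matrix G $$ (i, j) =
    (if i = j then real (vertex_degree G (vertex_list G ! i)) else 0) -
    of_bool ({vertex_list G ! i, vertex_list G ! j} \<in> edges G)"
  using assms no_loops by (auto simp: laplacian_matrix_def Let_def)

lemma laplacian_matrix_mult_vertex_vec:
  "laplacian_matrix G *\<^sub>v vertex_vec G f = vertex_vec G (graph_laplacian G f)"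
proof (rule eq_vecI)
  fix i assume "i < dim_vec (vertex_vec G (graph_laplacian G f))"
  then have i_less: "i < card (verts G)" by simp
  define u where "u = vertex_list G ! i"
  have "(laplacian_matrix G *\<^sub>v vertex_vec G f) $ i =
      (\<Sum>j<card (verts G). laplacian_matrix G $$ (i, j) * f (vertex_list G ! j))"
    using i_less carrier_matD[OF laplacian_matrix_carrier]
    by (simp add: scalar_prod_def atLeast0LessThan vertex_vec_def)
  also have "\<dots> = (\<Sum>j<card (verts G). (if i = j then vertex_degree G u * f u else 0) -
      of_bool ({u, vertex_list G ! j} \<in> edges G) * f (vertex_list G ! j))"
    using i_less by (intro sum.cong) (auto simp: laplacian_matrix_entry u_def left_diff_distrib)
  also have "\<dots> = vertex_degree G u * f u - (\<Sum>v\<in>verts G. of_bool ({u, v} \<in> edges G) * f v)"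
    using i_less sum_vertex_list[of "\<lambda>v. of_bool ({u, v} \<in> edges G) * f v"]
    by (simp add: sum_subtractf)
  also have "\<dots> = graph_laplacian G f u"
    using finite_verts
    by (simp add: graph_laplacian_def vertex_degree_def sum_subtractf sum.inter_filter[symmetric]
        of_bool_def if_distrib[of "\<lambda>x. x * _"] cong: if_cong)
  finally show "(laplacian_matrix G *\<^sub>v vertex_vec G f) $ i = vertex_vec G (graph_laplacian G f) $ i"
    using i_less by (simp add: vertex_vec_def u_def)
qed (use carrier_matD[OF laplacian_matrix_carrier] in simp)

lemma laplacian_matrix_root_iff:
  "poly (char_poly (laplacian_matrix G)) \<mu> = 0 \<longleftrightarrow> (\<exists>f. laplacian_eigenfunction G \<mu> f)"
proof -
  have smult: "\<mu> \<cdot>\<^sub>v vertex_vec G f = vertex_vec G (\<lambda>u. \<mu> * f u)"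
    and zero: "0\<^sub>v (card (verts G)) = vertex_vec G (\<lambda>_. 0)" for f
    by (auto simp: vertex_vec_def)
  have "eigenvector (laplacian_matrix G) (vertex_vec G f) \<mu> \<longleftrightarrow> laplacian_eigenfunction G \<mu> f" for f
    using carrier_matD[OF laplacian_matrix_carrier]
    by (auto simp: eigenvector_def laplacian_eigenfunction_def laplacian_matrix_mult_vertex_vec
        smult zero vertex_vec_eq_iff)
  moreover have "eigenvector (laplacian_matrix G) v \<mu> \<Longrightarrow> \<exists>f. v = vertex_vec G f" for v
    using vertex_vec_surj carrier_matD[OF laplacian_matrix_carrier]
    unfolding eigenvector_def by metis
  ultimately show ?thesis
    unfolding eigenvalue_root_char_poly[OF laplacian_matrix_carrier, symmetric] eigenvalue_def
    by metis
qed

end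

text \<open>If the all-ones vector is an eigenvector of \<open>A\<close>, this is the map induced on the
  quotient by it.\<close>

definition deflate :: "'a :: ring mat \<Rightarrow> 'a mat" where
  "deflate A = mat (dim_row A - 1) (dim_col A - 1) (\<lambda>(i, j). A $$ (Suc i, Suc j) - A $$ (0, Suc j))"

lemma deflate_carrier [simp]:
  "A \<in> carrier_mat (Suc m) (Suc n) \<Longrightarrow> deflate A \<in> carrier_mat m n"
  by (simp add: deflate_def)

lemma deflate_mult_vec:
  fixes A :: "'a :: comm_ring mat"
  assumes "A \<in> carrier_mat (Suc m) (Suc n)" "z \<in> carrier_vec n" "i < m"
  shows "(deflate A *\<^sub>v z) $ i = (A *\<^sub>v vCons 0 z) $ Suc i - (A *\<^sub>v vCons 0 z) $ 0"
  using assms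
  by (simp add: deflate_def scalar_prod_def sum.atLeast0_lessThan_Suc_shift sum_subtractf
      left_diff_distrib del: sum.op_ivl_Suc)

lemma unitriangular_block_mult_inverse:
  fixes X :: "'a :: comm_ring_1 mat"
  assumes "X \<in> carrier_mat m k"
  shows "four_block_mat (1\<^sub>m k) (0\<^sub>m k m) X (1\<^sub>m m) *
    four_block_mat (1\<^sub>m k) (0\<^sub>m k m) (- X) (1\<^sub>m m) = 1\<^sub>m (k + m)"
  using assms
  by (subst mult_four_block_mat[of _ k k _ m _ m _ _ k _ m]) (auto intro!: eq_matI)

lemma similar_mat_constant_row_sums:
  fixes A :: "'a :: comm_ring_1 mat"
  assumes A_carrier: "A \<in> carrier_mat (Suc m) (Suc m)"
    and rows: "\<And>i. i < Suc m \<Longrightarrow> (\<Sum>j<Suc m. A $$ (i, j)) = s"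
  shows "similar_mat A
    (four_block_mat (mat 1 1 (\<lambda>_. s)) (mat 1 m (\<lambda>(i, j). A $$ (i, Suc j))) (0\<^sub>m m 1) (deflate A))"
proof -
  define one :: "'a mat" where "one = mat m 1 (\<lambda>_. 1)"
  define a b c d where "a = mat 1 1 (($$) A)" and "b = mat 1 m (\<lambda>(i, j). A $$ (i, Suc j))"
    and "c = mat m 1 (\<lambda>(i, j). A $$ (Suc i, j))" and "d = mat m m (\<lambda>(i, j). A $$ (Suc i, Suc j))"
  note block_defs = a_def b_def c_def d_def
  \<comment> \<open>Change to the basis in which the first unit vector is replaced by the all-ones vector.\<close>
  define P where "P = four_block_mat (1\<^sub>m 1) (0\<^sub>m 1 m) one (1\<^sub>m m)"
  define Q where "Q = four_block_mat (1\<^sub>m 1) (0\<^sub>m 1 m) (- one) (1\<^sub>m m)"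
  define B where "B = four_block_mat (mat 1 1 (\<lambda>_. s)) b (0\<^sub>m m 1) (deflate A)"
  have blocks: "a \<in> carrier_mat 1 1" "b \<in> carrier_mat 1 m" "c \<in> carrier_mat m 1"
    "d \<in> carrier_mat m m" "deflate A \<in> carrier_mat m m" "one \<in> carrier_mat m 1"
    using A_carrier by (auto simp: block_defs one_def)
  then have carrier: "P \<in> carrier_mat (Suc m) (Suc m)" "Q \<in> carrier_mat (Suc m) (Suc m)"
    "B \<in> carrier_mat (Suc m) (Suc m)"
    by (auto simp: P_def Q_def B_def intro!: carrier_matI)
  have inverse: "P * Q = 1\<^sub>m (Suc m)" "Q * P = 1\<^sub>m (Suc m)"
    using unitriangular_block_mult_inverse[of one m 1]
      unitriangular_block_mult_inverse[of "- one" m 1] blocks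
    by (simp_all add: P_def Q_def)
  have "A = four_block_mat a b c d"
    using A_carrier by (intro eq_matI) (auto simp: block_defs)
  then have "A * P = four_block_mat (a + b * one) b (c + d * one) d"
    unfolding P_def using blocks by (simp add: mult_four_block_mat[of _ 1 1 _ m _ m _ _ 1 _ m])
  also have "\<dots> = four_block_mat (mat 1 1 (\<lambda>_. s)) b (one * mat 1 1 (\<lambda>_. s)) (one * b + deflate A)"
  proof -
    have "A $$ (i, 0) + (\<Sum>j<m. A $$ (i, Suc j)) = s" if "i < Suc m" for i
      using rows[OF that] by (simp add: sum.lessThan_Suc_shift del: sum.lessThan_Suc)
    then have "a + b * one = mat 1 1 (\<lambda>_. s)" "c + d * one = one * mat 1 1 (\<lambda>_. s)"
      "d = one * b + deflate A"
      using A_carrier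
      by (auto simp: block_defs one_def deflate_def scalar_prod_def atLeast0LessThan
          intro!: eq_matI)
    then show ?thesis by simp
  qed
  also have "\<dots> = P * B"
    unfolding P_def B_def using blocks
    by (simp add: mult_four_block_mat[of _ 1 1 _ m _ m _ _ 1 _ m])
  finally have "A * (P * Q) = P * B * Q" using A_carrier carrier by (simp flip: assoc_mult_mat)
  then have "A = P * B * Q" using A_carrier by (simp add: inverse)
  then have "similar_mat A B"
    using A_carrier inverse carrier by (intro similar_matI[of _ _ P Q "Suc m"]) auto
  then show ?thesis by (simp add: B_def b_def)
qed

lemma char_poly_constant_row_sums:
  fixes A :: "'a :: field mat"
  assumes A_carrier: "A \<in> carrier_mat (Suc m) (Suc m)"
    and rows: "\<And>i. i < Suc m \<Longrightarrow> (\<Sum>j<Suc m. A $$ (i, j)) = s"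
  shows "char_poly A = [:- s, 1:] * char_poly (deflate A)"
proof -
  let ?b = "mat 1 m (\<lambda>(i, j). A $$ (i, Suc j))"
  have "char_poly A = char_poly (four_block_mat (mat 1 1 (\<lambda>_. s)) ?b (0\<^sub>m m 1) (deflate A))"
    by (rule char_poly_similar[OF similar_mat_constant_row_sums[OF A_carrier rows]])
  also have "\<dots> = char_poly (mat 1 1 (\<lambda>_. s)) * char_poly (deflate A)"
    using A_carrier by (intro char_poly_four_block_zeros_col) auto
  also have "char_poly (mat 1 1 (\<lambda>_. s)) = [:- s, 1:]"
    by (simp add: char_poly_def char_poly_matrix_def det_single)
  finally show ?thesis .
qed

lemma sorted_proots_linear_factor_nth_1:
  fixes p :: "'a :: {idom, linorder} poly"
  assumes "p \<noteq> 0" "poly p l = 0" "a \<le> l" and least: "\<And>\<mu>. poly p \<mu> = 0 \<Longrightarrow> l \<le> \<mu>"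
  shows "sorted_list_of_multiset (proots ([:- a, 1:] * p)) ! 1 = l"
proof -
  have "l \<in># proots p" using assms by simp
  then obtain M where proots_eq: "proots p = add_mset l M" by (metis mset_add)
  have "l \<le> \<mu>" if "\<mu> \<in># M" for \<mu>
  proof (rule least)
    have "\<mu> \<in># proots p" using that by (simp add: proots_eq)
    then show "poly p \<mu> = 0" using \<open>p \<noteq> 0\<close> by simp
  qed
  then have "sorted_list_of_multiset (add_mset l M) = l # sorted_list_of_multiset M"
    by (simp add: insort_is_Cons)
  moreover have "proots ([:- a, 1:] * p) = add_mset a (add_mset l M)"
    using \<open>p \<noteq> 0\<close> by (subst proots_mult) (auto simp: proots_eq)
  ultimately show ?thesis using \<open>a \<le> l\<close> by simp
qed

context simple_graph
begin

lemma char_poly_laplacian_matrix: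
  assumes "verts G \<noteq> {}"
  shows "char_poly (laplacian_matrix G) = [:0, 1:] * char_poly (deflate (laplacian_matrix G))"
proof -
  obtain m where card_eq: "card (verts G) = Suc m"
    using assms finite_verts by (metis card_gt_0_iff gr0_conv_Suc)
  have "(\<Sum>j<Suc m. laplacian_matrix G $$ (i, j)) = 0" if "i < Suc m" for i
  proof -
    have "(\<Sum>j<Suc m. laplacian_matrix G $$ (i, j)) =
        (laplacian_matrix G *\<^sub>v vertex_vec G (\<lambda>_. 1)) $ i"
      using that card_eq carrier_matD[OF laplacian_matrix_carrier]
      by (simp add: scalar_prod_def atLeast0LessThan vertex_vec_def)
    also have "\<dots> = 0"
      using that card_eq
      by (simp add: laplacian_matrix_mult_vertex_vec) (simp add: vertex_vec_def graph_laplacian_def)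
    finally show ?thesis .
  qed
  then show ?thesis
    using char_poly_constant_row_sums[of "laplacian_matrix G" m 0] laplacian_matrix_carrier card_eq
    by simp
qed

lemma deflate_laplacian_matrix_kernel:
  assumes card_eq: "card (verts G) = Suc m" and z_carrier: "z \<in> carrier_vec m"
    and ker: "deflate (laplacian_matrix G) *\<^sub>v z = 0\<^sub>v m"
    and harmonic_constant: "\<And>f. (\<And>u. u \<in> verts G \<Longrightarrow> graph_laplacian G f u = 0) \<Longrightarrow>
      \<exists>a. \<forall>u\<in>verts G. f u = a"
  shows "z = 0\<^sub>v m"
proof -
  note L_carrier = laplacian_matrix_carrier[unfolded card_eq]
  obtain f where f_eq: "vCons 0 z = vertex_vec G f"
    using vertex_vec_surj z_carrier card_eq by (metis vCons_carrier_vec)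
  have mult: "laplacian_matrix G *\<^sub>v vCons 0 z = vertex_vec G (graph_laplacian G f)"
    unfolding f_eq by (rule laplacian_matrix_mult_vertex_vec)
  define c where "c = (laplacian_matrix G *\<^sub>v vCons 0 z) $ 0"
  have "(laplacian_matrix G *\<^sub>v vCons 0 z) $ i = c" if "i < Suc m" for i
    using deflate_mult_vec[OF L_carrier z_carrier, of "i - 1"] ker that
    by (cases i) (auto simp: c_def)
  then have "vertex_vec G (graph_laplacian G f) = vertex_vec G (\<lambda>_. c)"
    unfolding mult using card_eq by (intro eq_vecI) (auto simp: vertex_vec_def)
  then have lap: "graph_laplacian G f u = c" if "u \<in> verts G" for u
    using that by (simp add: vertex_vec_eq_iff)
  then have "of_nat (Suc m) * c = (\<Sum>u\<in>verts G. graph_laplacian G f u)" by (simp add: card_eq)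
  then have "c = 0" using sum_graph_laplacian[OF finite_verts, of f] by simp
  then obtain a where "\<forall>u\<in>verts G. f u = a" using harmonic_constant[of f] lap by blast
  then have const: "vCons 0 z = vertex_vec G (\<lambda>_. a)" unfolding f_eq vertex_vec_eq_iff .
  have "a = 0" using arg_cong[OF const, of "\<lambda>v. v $ 0"] by (simp add: vertex_vec_def card_eq)
  then have "vCons 0 z = vCons 0 (0\<^sub>v m)"
    unfolding const by (auto simp: vertex_vec_def card_eq vec_index_vCons)
  then show ?thesis by simp
qed

theorem algebraic_connectivity_eqI:
  assumes "0 < l" and poincare: "poincare_inequality G l" and eigen: "laplacian_eigenfunction G l y"
  shows "algebraic_connectivity G = l"
proof -
  define D where "D = deflate (laplacian_matrix G)"
  have "verts G \<noteq> {}" using eigen by (auto simp: laplacian_eigenfunction_def)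
  then obtain m where card_eq: "card (verts G) = Suc m"
    using finite_verts by (metis card_gt_0_iff gr0_conv_Suc)
  have D_carrier: "D \<in> carrier_mat m m" using laplacian_matrix_carrier card_eq by (simp add: D_def)
  have char_poly: "char_poly (laplacian_matrix G) = [:- 0, 1:] * char_poly D"
    using char_poly_laplacian_matrix[OF \<open>verts G \<noteq> {}\<close>] by (simp add: D_def)
  have "z = 0\<^sub>v m" if "z \<in> carrier_vec m" "D *\<^sub>v z = 0 \<cdot>\<^sub>v z" for z
  proof (rule deflate_laplacian_matrix_kernel[OF card_eq that(1)])
    show "deflate (laplacian_matrix G) *\<^sub>v z = 0\<^sub>v m" using that by (auto simp: D_def)
  qed (rule poincare_inequality_harmonic_constant[OF finite_verts poincare \<open>0 < l\<close>])
  then have "\<not> eigenvalue D 0" using D_carrier unfolding eigenvalue_def eigenvector_def by auto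
  then have simple_zero: "poly (char_poly D) 0 \<noteq> 0"
    by (simp add: eigenvalue_root_char_poly[OF D_carrier])
  have "l \<le> \<mu>" if "poly (char_poly D) \<mu> = 0" for \<mu>
  proof -
    have "poly (char_poly (laplacian_matrix G)) \<mu> = 0" using that by (simp add: char_poly)
    then obtain f where "laplacian_eigenfunction G \<mu> f" by (auto simp: laplacian_matrix_root_iff)
    then show ?thesis
      using that simple_zero
      by (intro poincare_inequality_le_eigenvalue[OF finite_verts poincare]) auto
  qed
  moreover have "poly (char_poly (laplacian_matrix G)) l = 0"
    using eigen by (auto simp: laplacian_matrix_root_iff)
  then have "poly (char_poly D) l = 0" using \<open>0 < l\<close> by (simp add: char_poly)
  moreover have "char_poly D \<noteq> 0" using simple_zero by auto
  ultimately have "sorted_list_of_multiset (proots ([:- 0, 1:] * char_poly D)) ! 1 = l"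
    using \<open>0 < l\<close> by (intro sorted_proots_linear_factor_nth_1) auto
  then show ?thesis unfolding algebraic_connectivity_def char_poly by simp
qed

end

section \<open>Fourier analysis on a cycle\<close>

definition dft :: "nat \<Rightarrow> (nat \<Rightarrow> complex) \<Rightarrow> nat \<Rightarrow> complex" where
  "dft n x r = (\<Sum>a<n. x a * cis (- (2 * pi * real r * real a / real n)))"

definition cycle_gap :: "nat \<Rightarrow> real" where
  "cycle_gap n = 2 - 2 * cos (2 * pi / real n)"

lemma cycle_gap_pos:
  assumes "n \<ge> 2"
  shows "0 < cycle_gap n"
proof -
  have "cos (2 * pi / real n) < cos 0"
    using assms by (intro cos_monotone_0_pi) (auto simp: field_simps)
  then show ?thesis by (simp add: cycle_gap_def)
qed

lemma cycle_gap_antimono: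
  assumes "2 \<le> m" "m \<le> n"
  shows "cycle_gap n \<le> cycle_gap m"
  unfolding cycle_gap_def using assms by (auto intro!: cos_monotone_0_pi_le simp: field_simps)

lemma sum_shift_periodic:
  fixes \<phi> :: "nat \<Rightarrow> 'a :: ab_group_add"
  assumes "\<And>a. \<phi> (a + n) = \<phi> a"
  shows "(\<Sum>a<n. \<phi> (a + k)) = (\<Sum>a<n. \<phi> a)"
proof (induction k)
  case (Suc k)
  have "\<phi> k + (\<Sum>a<n. \<phi> (Suc a + k)) = (\<Sum>a<Suc n. \<phi> (a + k))"
    by (subst sum.lessThan_Suc_shift) simp
  also have "\<dots> = (\<Sum>a<n. \<phi> (a + k)) + \<phi> k"
    using assms[of k] by (simp add: add.commute)
  finally show ?case using Suc by simp
qed simp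

lemma sum_cis_multiples:
  assumes "n > 0"
  shows "(\<Sum>r<n. cis (2 * pi * real r * real_of_int k / real n)) =
    (if int n dvd k then of_nat n else 0)"
proof -
  define z where "z = cis (2 * pi * real_of_int k / real n)"
  have power: "cis (2 * pi * real r * real_of_int k / real n) = z ^ r" for r
    by (simp add: z_def DeMoivre mult_ac)
  have "z ^ n = cis (2 * pi * real_of_int k)"
    using assms by (simp add: z_def DeMoivre)
  then have "z ^ n = 1" by (simp add: cis_multiple_2pi)
  moreover have "z = 1 \<longleftrightarrow> int n dvd k"
  proof -
    have "2 * pi * real_of_int k / real n = real_of_int j * (2 * pi) \<longleftrightarrow> k = int n * j" for j
    proof -
      have "2 * pi * real_of_int k / real n = real_of_int j * (2 * pi) \<longleftrightarrow>
          real_of_int k = real_of_int (int n * j)"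
        using assms by (simp add: field_simps)
      then show ?thesis by (simp only: of_int_eq_iff)
    qed
    then show ?thesis by (simp add: z_def cis_eq_1_iff dvd_def)
  qed
  ultimately show ?thesis unfolding power by (auto simp: geometric_sum)
qed

lemma dft_diff: "dft n (\<lambda>a. x a - y a) r = dft n x r - dft n y r"
  by (simp add: dft_def sum_subtractf algebra_simps)

lemma dft_0: "dft n x 0 = (\<Sum>a<n. x a)"
  by (simp add: dft_def)

lemma dft_shift:
  assumes "n > 0" "\<And>a. x (a + n) = x a"
  shows "dft n (\<lambda>a. x (a + k)) r = cis (2 * pi * real r * real k / real n) * dft n x r"
proof -
  define \<phi> where "\<phi> a = x a * cis (- (2 * pi * real r * real a / real n))" for a
  have "\<phi> (a + n) = \<phi> a" for a
  proof -
    have "cis (- (2 * pi * real r * real (a + n) / real n)) =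
        cis (- (2 * pi * real r * real a / real n)) * cis (2 * pi * (- real r))"
      unfolding cis_mult using assms(1) by (intro arg_cong[of _ _ cis]) (simp add: field_simps)
    also have "cis (2 * pi * (- real r)) = 1" by (rule cis_multiple_2pi) auto
    finally show ?thesis by (simp add: \<phi>_def assms(2))
  qed
  then have "(\<Sum>a<n. \<phi> (a + k)) = (\<Sum>a<n. \<phi> a)" by (rule sum_shift_periodic)
  moreover have "x (a + k) * cis (- (2 * pi * real r * real a / real n)) =
      cis (2 * pi * real r * real k / real n) * \<phi> (a + k)" for a
    by (simp add: \<phi>_def mult.left_commute[of _ "x _"] cis_mult distrib_left add_divide_distrib)
  ultimately show ?thesis
    by (simp add: dft_def flip: sum_distrib_left) (simp add: \<phi>_def)
qed

theorem parseval: "(\<Sum>r<n. (cmod (dft n x r))\<^sup>2) = real n * (\<Sum>a<n. (cmod (x a))\<^sup>2)"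
proof (cases "n = 0")
  case False
  let ?\<chi> = "\<lambda>a b r. cis (2 * pi * real r * real_of_int (int b - int a) / real n)"
  have "complex_of_real ((cmod (dft n x r))\<^sup>2) = (\<Sum>a<n. \<Sum>b<n. x a * cnj (x b) * ?\<chi> a b r)" for r
  proof -
    have "complex_of_real ((cmod (dft n x r))\<^sup>2) = dft n x r * cnj (dft n x r)"
      by (metis complex_norm_square of_real_power)
    also have "\<dots> = (\<Sum>a<n. \<Sum>b<n. x a * cnj (x b) *
        (cis (- (2 * pi * real r * real a / real n)) * cis (2 * pi * real r * real b / real n)))"
      unfolding dft_def cnj_sum sum_product by (simp add: cis_cnj mult_ac)
    finally show ?thesis
      by (simp add: cis_mult right_diff_distrib diff_divide_distrib)
  qed
  then have "complex_of_real (\<Sum>r<n. (cmod (dft n x r))\<^sup>2) =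
      (\<Sum>r<n. \<Sum>a<n. \<Sum>b<n. x a * cnj (x b) * ?\<chi> a b r)" by simp
  also have "\<dots> = (\<Sum>a<n. \<Sum>b<n. x a * cnj (x b) * (\<Sum>r<n. ?\<chi> a b r))"
    unfolding sum_distrib_left by (subst sum.swap, subst (2) sum.swap) simp
  also have "\<dots> = (\<Sum>a<n. \<Sum>b<n. if a = b then of_nat n * (x a * cnj (x a)) else 0)"
  proof (intro sum.cong refl)
    fix a b assume "a \<in> {..<n}" "b \<in> {..<n}"
    then have "int n dvd int b - int a \<longleftrightarrow> a = b"
      using zdvd_imp_le[of "int n" "\<bar>int b - int a\<bar>"] by fastforce
    then show "x a * cnj (x b) * (\<Sum>r<n. ?\<chi> a b r) =
        (if a = b then of_nat n * (x a * cnj (x a)) else 0)"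
      using sum_cis_multiples[of n "int b - int a"] False by simp
  qed
  also have "\<dots> = complex_of_real (real n * (\<Sum>a<n. (cmod (x a))\<^sup>2))"
    by (simp add: sum_distrib_left flip: complex_norm_square)
  finally show ?thesis by (simp only: of_real_eq_iff)
qed simp

lemma cmod_cis_minus_1: "(cmod (cis t - 1))\<^sup>2 = 2 - 2 * cos t"
  using sin_cos_squared_add[of t] unfolding cmod_power2
  by (simp add: power2_eq_square algebra_simps)

lemma cos_le_cos_away:
  assumes "0 \<le> t" "t \<le> x" "x \<le> 2 * pi - t"
  shows "cos x \<le> cos t"
proof (cases "x \<le> pi")
  case False
  then have "cos (2 * pi - x) \<le> cos t" using assms by (intro cos_monotone_0_pi_le) auto
  then show ?thesis by simp
qed (use assms in \<open>auto intro: cos_monotone_0_pi_le\<close>)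

theorem cycle_poincare:
  fixes x :: "nat \<Rightarrow> complex"
  assumes per: "\<And>a. x (a + n) = x a" and sum0: "(\<Sum>a<n. x a) = 0"
  shows "cycle_gap n * (\<Sum>a<n. (cmod (x a))\<^sup>2) \<le> (\<Sum>a<n. (cmod (x (a + 1) - x a))\<^sup>2)"
proof (cases "n = 0")
  case False
  define \<Delta> where "\<Delta> a = x (a + 1) - x a" for a
  have "cycle_gap n * (cmod (dft n x r))\<^sup>2 \<le> (cmod (dft n \<Delta> r))\<^sup>2" if "r < n" for r
  proof (cases "r = 0")
    case True
    then show ?thesis by (simp add: dft_0 sum0)
  next
    case False
    define t where "t = 2 * pi * real r / real n"
    have "dft n \<Delta> r = dft n (\<lambda>a. x (a + 1)) r - dft n x r"
      unfolding \<Delta>_def by (rule dft_diff)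
    also have "\<dots> = (cis t - 1) * dft n x r"
      using dft_shift[of n x 1 r] per that by (simp add: t_def algebra_simps)
    finally have "dft n \<Delta> r = (cis t - 1) * dft n x r" .
    then have dft_diff_eq: "(cmod (dft n \<Delta> r))\<^sup>2 = (2 - 2 * cos t) * (cmod (dft n x r))\<^sup>2"
      by (simp add: norm_mult power_mult_distrib cmod_cis_minus_1)
    have "2 * pi * (real r + 1) \<le> 2 * pi * real n" using that by (intro mult_left_mono) auto
    then have "cos t \<le> cos (2 * pi / real n)"
      unfolding t_def using that False by (intro cos_le_cos_away) (auto simp: field_simps)
    then show ?thesis unfolding dft_diff_eq cycle_gap_def by (intro mult_right_mono) auto
  qed
  then have "(\<Sum>r<n. cycle_gap n * (cmod (dft n x r))\<^sup>2) \<le> (\<Sum>r<n. (cmod (dft n \<Delta> r))\<^sup>2)"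
    by (intro sum_mono) auto
  then have "real n * (cycle_gap n * (\<Sum>a<n. (cmod (x a))\<^sup>2)) \<le> real n * (\<Sum>a<n. (cmod (\<Delta> a))\<^sup>2)"
    unfolding parseval sum_distrib_left[symmetric] by (simp add: mult_ac)
  then show ?thesis using False by (simp add: \<Delta>_def)
qed simp

section \<open>Two tokens on a cycle\<close>

text \<open>Fourier mode \<open>r\<close> in the centre of mass of two tokens on the \<open>n\<close>-cycle leaves the form
  \<open>path_form n (cos (pi * r / n))\<close> in their distance \<open>d\<close>, restricted to functions of parity
  \<open>(-1) ^ r\<close> under \<open>d \<mapsto> n - d\<close>.\<close>

definition path_form :: "nat \<Rightarrow> real \<Rightarrow> (nat \<Rightarrow> 'a :: real_inner) \<Rightarrow> real" where
  "path_form n c g =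
    (\<Sum>d\<in>{1..<n-1}. 2 * (norm (g d))\<^sup>2 + 2 * (norm (g (d + 1)))\<^sup>2 - 4 * c * inner (g d) (g (d + 1)))"

lemma path_form_uminus: "path_form n (- c) g = path_form n c (\<lambda>d. (-1) ^ d *\<^sub>R g d)"
  by (simp add: path_form_def flip: mult.assoc power_add)

lemma sum_consecutive:
  fixes \<phi> :: "nat \<Rightarrow> 'a :: comm_ring_1"
  assumes "2 \<le> n"
  shows "(\<Sum>d\<in>{1..<n-1}. \<phi> d + \<phi> (d + 1)) = 2 * (\<Sum>d\<in>{1..<n}. \<phi> d) - \<phi> 1 - \<phi> (n - 1)"
  using assms
proof (induction n rule: dec_induct)
  case base
  have "{1..<2} = {1 :: nat}" by auto
  then show ?case by simp
next
  case (step n)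
  then show ?case by (cases n) auto
qed

lemma path_form_ge_if_abs_le:
  fixes g :: "nat \<Rightarrow> 'a :: real_inner"
  assumes n_ge_3: "3 \<le> n" and c_bounds: "\<bar>c\<bar> \<le> c'" "c' \<le> 1"
  shows "(2 - 2 * c') * (\<Sum>d\<in>{1..<n}. (norm (g d))\<^sup>2) \<le> path_form n c g"
proof -
  have edge: "(2 - 2 * c') * ((norm u)\<^sup>2 + (norm v)\<^sup>2) \<le>
      2 * (norm u)\<^sup>2 + 2 * (norm v)\<^sup>2 - 4 * c * inner u v"
    for u v :: 'a
  proof -
    have "2 * (c * inner u v) \<le> \<bar>c\<bar> * (2 * norm u * norm v)"
      using mult_left_mono[OF Cauchy_Schwarz_ineq2, of "\<bar>c\<bar>" u v] abs_ge_self[of "c * inner u v"]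
      by (simp add: abs_mult)
    also have "\<dots> \<le> c' * ((norm u)\<^sup>2 + (norm v)\<^sup>2)"
      using c_bounds sum_squares_bound[of "norm u" "norm v"] by (intro mult_mono) auto
    finally show ?thesis by (simp add: algebra_simps)
  qed
  have "(norm (g 1))\<^sup>2 + (norm (g (n - 1)))\<^sup>2 = (\<Sum>d\<in>{1, n - 1}. (norm (g d))\<^sup>2)" using n_ge_3 by simp
  also have "\<dots> \<le> (\<Sum>d\<in>{1..<n}. (norm (g d))\<^sup>2)" using n_ge_3 by (intro sum_mono2) auto
  finally have "(\<Sum>d\<in>{1..<n}. (norm (g d))\<^sup>2) \<le> (\<Sum>d\<in>{1..<n-1}. (norm (g d))\<^sup>2 + (norm (g (d + 1)))\<^sup>2)"
    using n_ge_3 by (subst sum_consecutive) auto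
  then have "(2 - 2 * c') * (\<Sum>d\<in>{1..<n}. (norm (g d))\<^sup>2) \<le>
      (2 - 2 * c') * (\<Sum>d\<in>{1..<n-1}. (norm (g d))\<^sup>2 + (norm (g (d + 1)))\<^sup>2)"
    using c_bounds by (intro mult_left_mono) auto
  also have "\<dots> \<le> path_form n c g"
    unfolding path_form_def sum_distrib_left by (intro sum_mono edge)
  finally show ?thesis .
qed

lemma two_inner_le_weighted:
  fixes u v :: "'a :: real_inner"
  assumes "0 < \<alpha>"
  shows "2 * inner u v \<le> \<alpha> * (norm u)\<^sup>2 + (norm v)\<^sup>2 / \<alpha>"
proof -
  have "0 \<le> (norm (\<alpha> *\<^sub>R u - v))\<^sup>2 / \<alpha>" using assms by simp
  also have "\<dots> = \<alpha> * (norm u)\<^sup>2 + (norm v)\<^sup>2 / \<alpha> - 2 * inner u v"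
    using assms
    by (simp add: power2_norm_eq_inner inner_diff_left inner_diff_right inner_commute[of v u]
        field_simps)
  finally show ?thesis by simp
qed

lemma cos_minus_sin_mult_tan:
  fixes x \<theta> :: real
  assumes "cos x \<noteq> 0"
  shows "cos \<theta> - sin \<theta> * tan x = cos (x + \<theta>) / cos x"
  using assms by (simp add: tan_def cos_add field_simps)

text \<open>Picone's inequality for the ground state \<open>cos\<close>: along a path with step \<open>\<theta>\<close> the \<open>tan\<close>
  terms telescope.\<close>

lemma two_inner_le_tan:
  fixes u v :: "'a :: real_inner" and x \<theta> :: real
  assumes nonneg: "0 \<le> cos x * cos (x + \<theta>)"
    and "cos x = 0 \<Longrightarrow> u = 0" "cos (x + \<theta>) = 0 \<Longrightarrow> v = 0"
  shows "2 * inner u v \<le> cos \<theta> * ((norm u)\<^sup>2 + (norm v)\<^sup>2) -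
    sin \<theta> * (tan x * (norm u)\<^sup>2 - tan (x + \<theta>) * (norm v)\<^sup>2)"
proof -
  have coeff_u: "(cos \<theta> - sin \<theta> * tan x) * (norm u)\<^sup>2 = cos (x + \<theta>) / cos x * (norm u)\<^sup>2"
    using assms(2) by (cases "cos x = 0") (simp_all add: cos_minus_sin_mult_tan)
  have coeff_v: "(cos \<theta> + sin \<theta> * tan (x + \<theta>)) * (norm v)\<^sup>2 = cos x / cos (x + \<theta>) * (norm v)\<^sup>2"
    using assms(3) cos_minus_sin_mult_tan[of "x + \<theta>" "- \<theta>"]
    by (cases "cos (x + \<theta>) = 0") simp_all
  have "2 * inner u v \<le> cos (x + \<theta>) / cos x * (norm u)\<^sup>2 + cos x / cos (x + \<theta>) * (norm v)\<^sup>2"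
  proof (cases "cos x = 0 \<or> cos (x + \<theta>) = 0")
    case True
    then show ?thesis using assms(2,3) by auto
  next
    case False
    then have "0 < cos x * cos (x + \<theta>)" using nonneg by (simp add: less_le)
    then have "0 < cos (x + \<theta>) / cos x" by (auto simp: zero_less_mult_iff zero_less_divide_iff)
    then show ?thesis
      using two_inner_le_weighted[of "cos (x + \<theta>) / cos x" u v] by (simp add: mult.commute)
  qed
  then show ?thesis unfolding coeff_u[symmetric] coeff_v[symmetric] by (simp add: algebra_simps)
qed

lemma two_inner_uminus_eq_tan:
  fixes u :: "'a :: real_inner" and x \<theta> :: real
  assumes "cos x \<noteq> 0" and mirror: "x + \<theta> = pi - x"
  shows "2 * inner u (- u) = cos \<theta> * ((norm u)\<^sup>2 + (norm (- u))\<^sup>2) -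
    sin \<theta> * (tan x * (norm u)\<^sup>2 - tan (x + \<theta>) * (norm (- u))\<^sup>2)"
proof -
  have "cos \<theta> - sin \<theta> * tan x = -1"
    unfolding cos_minus_sin_mult_tan[OF assms(1)] mirror using assms(1) by simp
  then have "2 * inner u (- u) = (cos \<theta> - sin \<theta> * tan x) * (2 * (norm u)\<^sup>2)"
    by (simp add: power2_norm_eq_inner)
  moreover have "tan (x + \<theta>) = - tan x" unfolding mirror by (simp add: tan_def)
  ultimately show ?thesis by (simp add: left_diff_distrib)
qed

lemma cos_fraction_nonneg:
  assumes "2 * j \<le> n"
  shows "0 \<le> cos (real j * (pi / real n))"
proof (cases "n = 0")
  case False
  have "real (2 * j) \<le> real n" using assms by (simp only: of_nat_le_iff)
  then have "real j * (pi / real n) \<le> pi / 2" using False by (simp add: field_simps)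
  then show ?thesis by (intro cos_ge_zero) (auto intro: order.trans[of _ 0])
qed simp

lemma cos_fraction_reflect:
  assumes "j \<le> n" "0 < n"
  shows "cos (real (n - j) * (pi / real n)) = - cos (real j * (pi / real n))"
proof -
  have "real (n - j) * (pi / real n) = pi - real j * (pi / real n)"
    using assms by (simp add: of_nat_diff field_simps)
  then show ?thesis by simp
qed

lemma cos_fraction_mult_Suc_nonneg:
  assumes "d + 1 \<le> n" "n \<noteq> 2 * d + 1"
  shows "0 \<le> cos (real d * (pi / real n)) * cos (real (d + 1) * (pi / real n))"
proof (cases "2 * (d + 1) \<le> n")
  case True
  then show ?thesis by (intro mult_nonneg_nonneg cos_fraction_nonneg) auto
next
  case False
  then have "0 \<le> cos (real (n - d) * (pi / real n)) * cos (real (n - (d + 1)) * (pi / real n))"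
    using assms by (intro mult_nonneg_nonneg cos_fraction_nonneg) auto
  then show ?thesis
    using assms cos_fraction_reflect[of d n] cos_fraction_reflect[of "d + 1" n] by simp
qed

lemma cos_fraction_eq_0_imp:
  assumes "cos (real j * (pi / real n)) = 0" "j \<le> n" "0 < n"
  shows "2 * j = n"
proof -
  have "real j * (pi / real n) \<le> real n * (pi / real n)" using assms by (intro mult_right_mono) auto
  then have "real j * (pi / real n) = pi / 2"
    using assms cos_inj_pi[of "real j * (pi / real n)" "pi / 2"] by simp
  then have "real (2 * j) = real n" using assms by (simp add: field_simps)
  then show ?thesis by (simp only: of_nat_eq_iff)
qed

lemma antisymmetric_two_inner_le_tan:
  fixes g :: "nat \<Rightarrow> 'a :: real_inner"
  assumes anti: "\<And>d. 1 \<le> d \<Longrightarrow> d < n \<Longrightarrow> g (n - d) = - g d"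
    and \<theta>: "\<theta> = pi / real n" and d_bounds: "1 \<le> d" "d + 1 < n"
  shows "2 * inner (g d) (g (d + 1)) \<le> cos \<theta> * ((norm (g d))\<^sup>2 + (norm (g (d + 1)))\<^sup>2) -
    sin \<theta> * (tan (real d * \<theta>) * (norm (g d))\<^sup>2 - tan (real (d + 1) * \<theta>) * (norm (g (d + 1)))\<^sup>2)"
proof -
  have step: "real (d + 1) * \<theta> = real d * \<theta> + \<theta>" by (simp add: algebra_simps)
  show ?thesis
  proof (cases "n = 2 * d + 1")
    case True
    then have g_Suc: "g (d + 1) = - g d" using anti[of d] d_bounds by simp
    have "real n * \<theta> = pi" using d_bounds by (simp add: \<theta>)
    then have mirror: "real d * \<theta> + \<theta> = pi - real d * \<theta>" using True by (simp add: algebra_simps)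
    have "cos (real d * \<theta>) \<noteq> 0" unfolding \<theta> using cos_fraction_eq_0_imp[of d n] True by auto
    then show ?thesis unfolding g_Suc step using mirror by (intro eq_refl two_inner_uminus_eq_tan)
  next
    case False
    have vanish: "g j = 0" if "cos (real j * \<theta>) = 0" "1 \<le> j" "j < n" for j
    proof -
      have "n - j = j" using cos_fraction_eq_0_imp[of j n] that unfolding \<theta> by simp
      then have "g j = - g j" using anti[OF that(2,3)] by (simp only:)
      then show ?thesis by (metis add.right_inverse scaleR_2 scaleR_eq_0_iff zero_neq_numeral)
    qed
    show ?thesis
      unfolding step
    proof (rule two_inner_le_tan)
      show "0 \<le> cos (real d * \<theta>) * cos (real d * \<theta> + \<theta>)"
        using cos_fraction_mult_Suc_nonneg[of d n] d_bounds False unfolding \<theta>[symmetric] step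
        by simp
      show "g d = 0" if "cos (real d * \<theta>) = 0"
        using vanish[of d] that d_bounds by simp
      show "g (d + 1) = 0" if "cos (real d * \<theta> + \<theta>) = 0"
        using vanish[of "d + 1"] that d_bounds unfolding step by simp
    qed
  qed
qed

lemma path_form_ge_antisymmetric:
  fixes g :: "nat \<Rightarrow> 'a :: real_inner"
  assumes n_ge_3: "3 \<le> n" and anti: "\<And>d. 1 \<le> d \<Longrightarrow> d < n \<Longrightarrow> g (n - d) = - g d"
  shows "cycle_gap n * (\<Sum>d\<in>{1..<n}. (norm (g d))\<^sup>2) \<le> path_form n (cos (pi / real n)) g"
proof -
  define \<theta> where "\<theta> = pi / real n"
  define N where "N d = (norm (g d))\<^sup>2" for d
  define \<tau> where "\<tau> d = tan (real d * \<theta>) * N d" for d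
  have cos_pos: "0 < cos \<theta>"
    unfolding \<theta>_def using n_ge_3
    by (intro cos_gt_zero_pi) (auto simp: field_simps intro: less_le_trans[of _ 0])
  have ends: "\<tau> 1 - \<tau> (n - 1) = tan \<theta> * (N 1 + N (n - 1))"
  proof -
    have "real (n - 1) * \<theta> = pi - \<theta>" using n_ge_3 by (simp add: \<theta>_def of_nat_diff field_simps)
    then have "tan (real (n - 1) * \<theta>) = - tan \<theta>" by (simp add: tan_def)
    then show ?thesis by (simp add: \<tau>_def distrib_left)
  qed
  have edge: "2 * (sin \<theta>)\<^sup>2 * (N d + N (d + 1)) + 2 * sin \<theta> * cos \<theta> * (\<tau> d - \<tau> (d + 1)) \<le>
      2 * N d + 2 * N (d + 1) - 4 * cos \<theta> * inner (g d) (g (d + 1))" if "d \<in> {1..<n-1}" for d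
  proof -
    have "2 * inner (g d) (g (d + 1)) \<le> cos \<theta> * (N d + N (d + 1)) - sin \<theta> * (\<tau> d - \<tau> (d + 1))"
      unfolding N_def \<tau>_def using that
      by (intro antisymmetric_two_inner_le_tan[where g = g, OF anti \<theta>_def]) auto
    then have "2 * cos \<theta> * (2 * inner (g d) (g (d + 1))) \<le>
        2 * cos \<theta> * (cos \<theta> * (N d + N (d + 1)) - sin \<theta> * (\<tau> d - \<tau> (d + 1)))"
      using cos_pos by (intro mult_left_mono) auto
    then show ?thesis
      unfolding sin_squared_eq by (simp add: algebra_simps power2_eq_square)
  qed
  have "cycle_gap n * (\<Sum>d\<in>{1..<n}. N d) = 4 * (sin \<theta>)\<^sup>2 * (\<Sum>d\<in>{1..<n}. N d)"
    using cos_double_sin[of \<theta>] by (simp add: cycle_gap_def \<theta>_def)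
  also have "\<dots> = 2 * (sin \<theta>)\<^sup>2 * (2 * (\<Sum>d\<in>{1..<n}. N d) - N 1 - N (n - 1)) +
      2 * sin \<theta> * cos \<theta> * (\<tau> 1 - \<tau> (n - 1))"
    unfolding ends using cos_pos by (simp add: tan_def algebra_simps power2_eq_square)
  also have "\<tau> 1 - \<tau> (n - 1) = (\<Sum>d\<in>{1..<n-1}. \<tau> d - \<tau> (d + 1))"
    using n_ge_3 sum_Suc_diff'[of 1 "n - 1" "\<lambda>d. - \<tau> d"] by simp
  also have "2 * (\<Sum>d\<in>{1..<n}. N d) - N 1 - N (n - 1) = (\<Sum>d\<in>{1..<n-1}. N d + N (d + 1))"
    using n_ge_3 by (subst sum_consecutive) auto
  also have "2 * (sin \<theta>)\<^sup>2 * (\<Sum>d\<in>{1..<n-1}. N d + N (d + 1)) +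
      2 * sin \<theta> * cos \<theta> * (\<Sum>d\<in>{1..<n-1}. \<tau> d - \<tau> (d + 1)) \<le> path_form n (cos \<theta>) g"
    unfolding path_form_def sum_distrib_left sum.distrib[symmetric] N_def[symmetric]
    by (intro sum_mono edge)
  finally show ?thesis by (simp add: \<theta>_def N_def)
qed

lemma path_form_ge_symmetric:
  fixes g :: "nat \<Rightarrow> complex"
  assumes n_ge_3: "3 \<le> n" and sym: "g (n - 1) = g 1" and sum0: "(\<Sum>d\<in>{1..<n}. g d) = 0"
  shows "cycle_gap n * (\<Sum>d\<in>{1..<n}. (cmod (g d))\<^sup>2) \<le> path_form n 1 g"
proof -
  \<comment> \<open>Since \<open>g 1 = g (n - 1)\<close>, the path closes up to a cycle of length \<open>n - 1\<close> at no cost.\<close>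
  obtain m where m_props: "m \<ge> 2" "n = Suc m" using n_ge_3 by (cases n) auto
  define x where "x a = g (a mod m + 1)" for a
  have x_sum: "(\<Sum>a<m. \<phi> (x a)) = (\<Sum>d\<in>{1..<n}. \<phi> (g d))" for \<phi> :: "complex \<Rightarrow> 'b :: comm_monoid_add"
    unfolding m_props(2)
    by (rule sum.reindex_bij_witness[of _ "\<lambda>d. d - 1" "\<lambda>d. d + 1"]) (auto simp: x_def)
  have "cycle_gap n * (\<Sum>a<m. (cmod (x a))\<^sup>2) \<le> 2 * (cycle_gap m * (\<Sum>a<m. (cmod (x a))\<^sup>2))"
    using cycle_gap_antimono[of m n] cycle_gap_pos[of m] m_props
    by (simp only: mult.assoc[symmetric], intro mult_right_mono sum_nonneg) auto
  also have "\<dots> \<le> 2 * (\<Sum>a<m. (cmod (x (a + 1) - x a))\<^sup>2)"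
    using cycle_poincare[of x m] x_sum[of "\<lambda>y. y"] sum0 by (simp add: x_def)
  also have "(\<Sum>a<m. (cmod (x (a + 1) - x a))\<^sup>2) =
      (\<Sum>a<m - 1. (cmod (x (a + 1) - x a))\<^sup>2) + (cmod (x m - x (m - 1)))\<^sup>2"
    using m_props by (cases m) auto
  also have "x m - x (m - 1) = 0" using m_props sym by (simp add: x_def)
  also have "(\<Sum>a<m - 1. (cmod (x (a + 1) - x a))\<^sup>2) = (\<Sum>d\<in>{1..<n-1}. (cmod (g (d + 1) - g d))\<^sup>2)"
    unfolding m_props(2)
    by (rule sum.reindex_bij_witness[of _ "\<lambda>d. d - 1" "\<lambda>d. d + 1"]) (auto simp: x_def)
  also have "2 * ((\<Sum>d\<in>{1..<n-1}. (cmod (g (d + 1) - g d))\<^sup>2) + (cmod 0)\<^sup>2) = path_form n 1 g"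
    by (simp add: path_form_def sum_distrib_left power2_norm_eq_inner
        inner_diff_left inner_diff_right inner_commute algebra_simps)
  finally show ?thesis by (simp only: x_sum[of "\<lambda>y. (cmod y)\<^sup>2"])
qed

lemma path_form_ge_alternating:
  fixes g :: "nat \<Rightarrow> 'a :: real_inner"
  assumes n_ge_3: "3 \<le> n" and alternating: "\<And>d. 1 \<le> d \<Longrightarrow> d < n \<Longrightarrow> g (n - d) = (-1) ^ (n - 1) *\<^sub>R g d"
  shows "cycle_gap n * (\<Sum>d\<in>{1..<n}. (norm (g d))\<^sup>2) \<le> path_form n (- cos (pi / real n)) g"
proof -
  define f where "f d = (-1) ^ d *\<^sub>R g d" for d
  have "f (n - d) = - f d" if "1 \<le> d" "d < n" for d
  proof -
    have "(-1) ^ (n - d) * (-1) ^ (n - 1) = (- ((-1) ^ d) :: real)"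
      using that by (auto simp: minus_one_power_iff)
    then show ?thesis using alternating[OF that] by (simp add: f_def)
  qed
  then have "cycle_gap n * (\<Sum>d\<in>{1..<n}. (norm (f d))\<^sup>2) \<le> path_form n (cos (pi / real n)) f"
    by (rule path_form_ge_antisymmetric[OF n_ge_3])
  then show ?thesis unfolding path_form_uminus f_def by simp
qed

lemma abs_cos_middle_mode_le:
  assumes "2 \<le> r" "r + 2 \<le> n"
  shows "\<bar>cos (pi * real r / real n)\<bar> \<le> cos (2 * pi / real n)"
proof -
  have "2 * pi \<le> pi * real r" "pi * real (r + 2) \<le> pi * real n" using assms by auto
  then have angle: "2 * pi / real n \<le> pi * real r / real n"
    "pi * real r / real n \<le> pi - 2 * pi / real n"
    using assms by (auto simp: field_simps)
  have "0 \<le> 2 * pi / real n" "0 \<le> pi * real r / real n" by auto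
  then have "cos (pi * real r / real n) \<le> cos (2 * pi / real n)"
    "cos (pi - 2 * pi / real n) \<le> cos (pi * real r / real n)"
    using angle by (intro cos_monotone_0_pi_le; linarith)+
  then show ?thesis by simp
qed

theorem path_form_ge_cycle_gap:
  fixes g :: "nat \<Rightarrow> complex"
  assumes n_ge_3: "3 \<le> n" and r_less: "r < n"
    and parity: "\<And>d. 1 \<le> d \<Longrightarrow> d < n \<Longrightarrow> g (n - d) = (-1) ^ r *\<^sub>R g d"
    and sum0: "r = 0 \<Longrightarrow> (\<Sum>d\<in>{1..<n}. g d) = 0"
  shows "cycle_gap n * (\<Sum>d\<in>{1..<n}. (cmod (g d))\<^sup>2) \<le> path_form n (cos (pi * real r / real n)) g"
proof -
  consider (zero) "r = 0" | (first) "r = 1" | (last) "r = n - 1" | (middle) "2 \<le> r" "r + 2 \<le> n"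
    using r_less by linarith
  then show ?thesis
  proof cases
    case zero
    then show ?thesis using path_form_ge_symmetric[OF n_ge_3, of g] parity[of 1] n_ge_3 sum0 by simp
  next
    case first
    then show ?thesis using path_form_ge_antisymmetric[OF n_ge_3, of g] parity by simp
  next
    case last
    then have "pi * real r / real n = pi - pi / real n"
      using n_ge_3 by (simp add: of_nat_diff field_simps)
    then have "cos (pi * real r / real n) = - cos (pi / real n)" by simp
    then show ?thesis using path_form_ge_alternating[OF n_ge_3, of g] parity last by simp
  next
    case middle
    then show ?thesis
      unfolding cycle_gap_def using n_ge_3
      by (intro path_form_ge_if_abs_le abs_cos_middle_mode_le) auto
  qed
qed

lemma cmod_minus_cis_mult_sum:
  "(cmod (g - cis t * g'))\<^sup>2 + (cmod (g' - cis t * g))\<^sup>2 =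
    2 * (cmod g)\<^sup>2 + 2 * (cmod g')\<^sup>2 - 4 * cos t * inner g g'"
proof -
  have expand: "(cmod (u - v))\<^sup>2 = (cmod u)\<^sup>2 + (cmod v)\<^sup>2 - 2 * inner u v" for u v
    by (simp add: power2_norm_eq_inner inner_diff_left inner_diff_right inner_commute)
  have "inner g (cis t * g') + inner g' (cis t * g) = 2 * cos t * inner g g'"
    by (simp add: inner_complex_def algebra_simps)
  then show ?thesis unfolding expand by (simp add: norm_mult)
qed

lemma path_form_eq_twisted_energy:
  fixes g :: "nat \<Rightarrow> complex"
  assumes parity: "\<And>d. 1 \<le> d \<Longrightarrow> d < n \<Longrightarrow> g (n - d) = \<epsilon> *\<^sub>R g d" and "\<bar>\<epsilon>\<bar> = 1"
  shows "path_form n (cos t) g = 2 * (\<Sum>d\<in>{1..<n-1}. (cmod (g d - cis t * g (d + 1)))\<^sup>2)"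
proof -
  have "(\<Sum>d\<in>{1..<n-1}. (cmod (g (d + 1) - cis t * g d))\<^sup>2) =
      (\<Sum>d\<in>{1..<n-1}. (cmod (g (n - 1 - d + 1) - cis t * g (n - 1 - d)))\<^sup>2)"
    by (rule sum.reindex_bij_witness[of _ "\<lambda>d. n - 1 - d" "\<lambda>d. n - 1 - d"]) auto
  also have "\<dots> = (\<Sum>d\<in>{1..<n-1}. (cmod (g d - cis t * g (d + 1)))\<^sup>2)"
  proof (intro sum.cong refl)
    fix d assume "d \<in> {1..<n-1}"
    then have "g (n - 1 - d + 1) = \<epsilon> *\<^sub>R g d" "g (n - 1 - d) = \<epsilon> *\<^sub>R g (d + 1)"
      using parity[of d] parity[of "d + 1"] by (auto simp: Suc_diff_Suc)
    then show "(cmod (g (n - 1 - d + 1) - cis t * g (n - 1 - d)))\<^sup>2 =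
        (cmod (g d - cis t * g (d + 1)))\<^sup>2"
      using \<open>\<bar>\<epsilon>\<bar> = 1\<close> by (simp flip: scaleR_diff_right)
  qed
  finally show ?thesis
    by (simp add: path_form_def sum.distrib flip: cmod_minus_cis_mult_sum)
qed

lemma distance_mode_poincare:
  fixes F :: "nat \<Rightarrow> complex"
  assumes n_ge_3: "3 \<le> n" and r_less: "r < n"
    and reflect: "\<And>d. 1 \<le> d \<Longrightarrow> d < n \<Longrightarrow> F d = cis (2 * pi * real r * real d / real n) * F (n - d)"
    and sum0: "r = 0 \<Longrightarrow> (\<Sum>d\<in>{1..<n}. F d) = 0"
  shows "cycle_gap n * (\<Sum>d\<in>{1..<n}. (cmod (F d))\<^sup>2) \<le> 2 * (\<Sum>d\<in>{1..<n-1}. (cmod (F d - F (d + 1)))\<^sup>2)"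
proof -
  define t where "t = pi * real r / real n"
  define g where "g d = cis (- (real d * t)) * F d" for d
  have F_eq: "F d = cis (real d * t) * g d" for d
    by (simp add: g_def cis_mult flip: mult.assoc)
  have parity: "g (n - d) = (-1) ^ r *\<^sub>R g d" if d_bounds: "1 \<le> d" "d < n" for d
  proof -
    have "F (n - d) = cis (2 * pi * real r * real (n - d) / real n) * F d"
      using reflect[of "n - d"] d_bounds by simp
    then have "g (n - d) =
        cis (- (real (n - d) * t)) * (cis (2 * (real (n - d) * t)) * (cis (real d * t) * g d))"
      unfolding g_def[of "n - d"] F_eq[of d] by (simp add: t_def mult_ac)
    also have "\<dots> = cis (real (n - d) * t + real d * t) * g d"
      by (simp only: cis_mult mult.assoc[symmetric]) (simp add: algebra_simps)
    also have "real (n - d) * t + real d * t = real r * pi"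
      using d_bounds by (simp add: t_def of_nat_diff field_simps)
    also have "cis (real r * pi) = (-1) ^ r" by (simp add: DeMoivre flip: cis_pi)
    finally show ?thesis by (simp add: scaleR_conv_of_real)
  qed
  have "F d - F (d + 1) = cis (real d * t) * (g d - cis t * g (d + 1))" for d
    by (simp add: F_eq algebra_simps flip: cis_mult)
  then have energy: "(\<Sum>d\<in>{1..<n-1}. (cmod (F d - F (d + 1)))\<^sup>2) =
      (\<Sum>d\<in>{1..<n-1}. (cmod (g d - cis t * g (d + 1)))\<^sup>2)"
    by (simp add: norm_mult)
  have "cycle_gap n * (\<Sum>d\<in>{1..<n}. (cmod (g d))\<^sup>2) \<le> path_form n (cos t) g"
    unfolding t_def
    by (rule path_form_ge_cycle_gap[where g = g, OF n_ge_3 r_less parity])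
      (use sum0 in \<open>simp_all add: g_def t_def\<close>)
  also have "\<dots> = 2 * (\<Sum>d\<in>{1..<n-1}. (cmod (F d - F (d + 1)))\<^sup>2)"
    unfolding energy by (rule path_form_eq_twisted_energy[where g = g, OF parity]) auto
  finally show ?thesis by (simp add: F_eq norm_mult)
qed

theorem pair_poincare:
  fixes h :: "nat \<Rightarrow> nat \<Rightarrow> complex"
  assumes n_ge_3: "3 \<le> n" and per: "\<And>a d. h (a + n) d = h a d"
    and swap: "\<And>a d. 1 \<le> d \<Longrightarrow> d < n \<Longrightarrow> h (a + d) (n - d) = h a d"
    and sum0: "(\<Sum>a<n. \<Sum>d\<in>{1..<n}. h a d) = 0"
  shows "cycle_gap n * (\<Sum>a<n. \<Sum>d\<in>{1..<n}. (cmod (h a d))\<^sup>2) \<le>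
    2 * (\<Sum>a<n. \<Sum>d\<in>{1..<n-1}. (cmod (h a d - h a (d + 1)))\<^sup>2)"
proof -
  define F where "F r d = dft n (\<lambda>a. h a d) r" for r d
  have diff: "dft n (\<lambda>a. h a d - h a (d + 1)) r = F r d - F r (d + 1)" for r d
    by (simp only: F_def dft_diff)
  have mode: "cycle_gap n * (\<Sum>d\<in>{1..<n}. (cmod (F r d))\<^sup>2) \<le>
      2 * (\<Sum>d\<in>{1..<n-1}. (cmod (F r d - F r (d + 1)))\<^sup>2)" if r_less: "r < n" for r
  proof (rule distance_mode_poincare[OF n_ge_3 r_less])
    fix d assume d_bounds: "1 \<le> d" "d < n"
    have "F r d = dft n (\<lambda>a. h (a + d) (n - d)) r" using swap[OF d_bounds] by (simp add: F_def)
    also have "\<dots> = cis (2 * pi * real r * real d / real n) * F r (n - d)"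
      unfolding F_def using n_ge_3 per by (intro dft_shift) auto
    finally show "F r d = cis (2 * pi * real r * real d / real n) * F r (n - d)" .
  next
    have "(\<Sum>d\<in>{1..<n}. \<Sum>a<n. h a d) = 0" using sum0 by (subst sum.swap)
    then show "(\<Sum>d\<in>{1..<n}. F r d) = 0" if "r = 0" by (simp add: F_def dft_0 that)
  qed
  have parseval_sum: "real n * (\<Sum>a<n. \<Sum>d\<in>D. (cmod (\<phi> a d))\<^sup>2) =
      (\<Sum>r<n. \<Sum>d\<in>D. (cmod (dft n (\<lambda>a. \<phi> a d) r))\<^sup>2)" for \<phi> :: "nat \<Rightarrow> nat \<Rightarrow> complex" and D
    by (simp add: sum.swap[of _ D] parseval sum_distrib_left)
  have "real n * (cycle_gap n * (\<Sum>a<n. \<Sum>d\<in>{1..<n}. (cmod (h a d))\<^sup>2)) =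
      (\<Sum>r<n. cycle_gap n * (\<Sum>d\<in>{1..<n}. (cmod (F r d))\<^sup>2))"
    unfolding mult.left_commute[of "real n"] parseval_sum F_def by (simp add: sum_distrib_left)
  also have "\<dots> \<le> (\<Sum>r<n. 2 * (\<Sum>d\<in>{1..<n-1}. (cmod (F r d - F r (d + 1)))\<^sup>2))"
    by (intro sum_mono mode) auto
  also have "\<dots> = real n * (2 * (\<Sum>a<n. \<Sum>d\<in>{1..<n-1}. (cmod (h a d - h a (d + 1)))\<^sup>2))"
    unfolding mult.left_commute[of "real n"] parseval_sum diff by (simp add: sum_distrib_left)
  finally show ?thesis using n_ge_3 by simp
qed

section \<open>Graphs containing a cycle\<close>

lemma (in simple_graph) sum_edges_le_dirichlet_form:
  assumes "finite I" and inj: "inj_on (\<lambda>i. {p i, q i}) I"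
    and edge: "\<And>i. i \<in> I \<Longrightarrow> p i \<in> verts G \<and> q i \<in> verts G \<and> {p i, q i} \<in> edges G"
  shows "(\<Sum>i\<in>I. (f (p i) - f (q i))\<^sup>2) \<le> dirichlet_form G f"
proof -
  define \<phi> where "\<phi> e = (f (fst e) - f (snd e))\<^sup>2" for e
  define R where "R = (SIGMA u:verts G. {v. v \<in> verts G \<and> {u, v} \<in> edges G})"
  let ?pq = "\<lambda>i. (p i, q i)" and ?qp = "\<lambda>i. (q i, p i)"
  have inj_pq: "inj_on ?pq I" and inj_qp: "inj_on ?qp I"
    using inj by (auto simp: inj_on_def)
  have disjoint: "?pq ` I \<inter> ?qp ` I = {}"
  proof (rule ccontr)
    assume "?pq ` I \<inter> ?qp ` I \<noteq> {}"
    then obtain i j where same_pair: "i \<in> I" "j \<in> I" "p i = q j" "q i = p j" by auto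
    then have "i = j" by (intro inj_onD[OF inj]) auto
    then show False using same_pair edge[of i] no_loops by auto
  qed
  have "2 * (\<Sum>i\<in>I. (f (p i) - f (q i))\<^sup>2) = sum \<phi> (?pq ` I) + sum \<phi> (?qp ` I)"
    by (simp add: sum.reindex[OF inj_pq] sum.reindex[OF inj_qp] \<phi>_def power2_commute)
  also have "\<dots> = sum \<phi> (?pq ` I \<union> ?qp ` I)"
    using \<open>finite I\<close> disjoint by (intro sum.union_disjoint[symmetric]) auto
  also have "\<dots> \<le> sum \<phi> R"
    using finite_verts edge by (intro sum_mono2) (auto simp: R_def \<phi>_def insert_commute)
  also have "\<dots> = 2 * dirichlet_form G f"
    using finite_verts by (simp add: dirichlet_form_def R_def sum.Sigma \<phi>_def case_prod_unfold)
  finally show ?thesis by simp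
qed

lemma add_mod_cancel_left:
  fixes a d e n :: nat
  assumes "d < n" "e < n"
  shows "(a + d) mod n = (a + e) mod n \<longleftrightarrow> d = e"
  using assms cong_add_lcancel_nat[of a d e n] by (simp add: cong_def)

lemma inj_on_cycle_edge:
  fixes n :: nat
  assumes "3 \<le> n"
  shows "inj_on (\<lambda>i. {i, (i + 1) mod n}) {..<n}"
proof (rule inj_onI, rule ccontr)
  fix i j assume same_edge: "i \<in> {..<n}" "j \<in> {..<n}"
    "{i, (i + 1) mod n} = {j, (j + 1) mod n}" "i \<noteq> j"
  then have "i = (j + 1) mod n" "(i + 1) mod n = j" by (auto simp: doubleton_eq_iff)
  then have "(j + 2) mod n = (j + 0) mod n" using same_edge by (simp add: mod_simps)
  then show False using assms add_mod_cancel_left[of 2 n 0 j] by simp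
qed

lemma (in simple_graph) hamiltonian_cycle_poincare:
  assumes n_ge_3: "3 \<le> n" and bij: "bij_betw e {..<n} (verts G)"
    and cycle: "\<And>i. i < n \<Longrightarrow> {e i, e ((i + 1) mod n)} \<in> edges G"
  shows "poincare_inequality G (cycle_gap n)"
  unfolding poincare_inequality_def
proof (intro allI impI)
  fix f :: "'a \<Rightarrow> real" assume sum0: "(\<Sum>u\<in>verts G. f u) = 0"
  define x where "x a = complex_of_real (f (e (a mod n)))" for a
  have reindex: "(\<Sum>u\<in>verts G. \<phi> (f u)) = (\<Sum>a<n. \<phi> (f (e (a mod n))))" for \<phi> :: "real \<Rightarrow> real"
    unfolding sum.reindex_bij_betw[OF bij, symmetric] by simp
  have mem: "e i \<in> verts G" if "i < n" for i using bij that by (auto simp: bij_betw_def)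
  have inj: "inj_on (\<lambda>i. {e i, e ((i + 1) mod n)}) {..<n}"
  proof (rule inj_onI)
    fix i j assume same_edge: "i \<in> {..<n}" "j \<in> {..<n}"
      "{e i, e ((i + 1) mod n)} = {e j, e ((j + 1) mod n)}"
    then have "e ` {i, (i + 1) mod n} = e ` {j, (j + 1) mod n}" by simp
    then have "{i, (i + 1) mod n} = {j, (j + 1) mod n}"
      using same_edge n_ge_3
      by (subst (asm) inj_on_image_eq_iff[OF bij_betw_imp_inj_on[OF bij]]) auto
    then show "i = j" using inj_onD[OF inj_on_cycle_edge[OF n_ge_3]] same_edge by blast
  qed
  have "cycle_gap n * (\<Sum>a<n. (cmod (x a))\<^sup>2) \<le> (\<Sum>a<n. (cmod (x (a + 1) - x a))\<^sup>2)"
    using sum0 reindex[of "\<lambda>y. y"] by (intro cycle_poincare) (simp_all add: x_def flip: of_real_sum)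
  also have "\<dots> = (\<Sum>a<n. (f (e a) - f (e ((a + 1) mod n)))\<^sup>2)"
    by (intro sum.cong) (auto simp: x_def power2_commute simp flip: of_real_diff)
  also have "\<dots> \<le> dirichlet_form G f"
    using cycle inj mem n_ge_3 by (intro sum_edges_le_dirichlet_form) auto
  finally show "cycle_gap n * (\<Sum>u\<in>verts G. (f u)\<^sup>2) \<le> dirichlet_form G f"
    using reindex[of "\<lambda>y. y\<^sup>2"] by (simp add: x_def)
qed

section \<open>Token graphs\<close>

lemma verts_token_graph: "verts (token_graph k G) = {A. A \<subseteq> verts G \<and> finite A \<and> card A = k}"
  by (simp add: token_graph_def Let_def)

lemma edges_token_graph_iff:
  assumes "A \<in> verts (token_graph k G)" "B \<in> verts (token_graph k G)"
  shows "{A, B} \<in> edges (token_graph k G) \<longleftrightarrow> (\<exists>a b. {a, b} \<in> edges G \<and> sym_diff A B = {a, b})"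
proof
  assume "{A, B} \<in> edges (token_graph k G)"
  then obtain A' B' a b where edge: "{A, B} = {A', B'}" "{a, b} \<in> edges G" "sym_diff A' B' = {a, b}"
    by (auto simp: token_graph_def Let_def)
  then have "sym_diff A B = {a, b}" by (auto simp: doubleton_eq_iff)
  with edge show "\<exists>a b. {a, b} \<in> edges G \<and> sym_diff A B = {a, b}" by blast
next
  assume "\<exists>a b. {a, b} \<in> edges G \<and> sym_diff A B = {a, b}"
  with assms show "{A, B} \<in> edges (token_graph k G)"
    unfolding token_graph_def Let_def by auto
qed

context simple_graph
begin

lemma simple_graph_token_graph: "simple_graph (token_graph k G)"
proof
  show "finite (verts (token_graph k G))"
    using finite_verts by (auto simp: verts_token_graph intro: finite_subset[of _ "Pow (verts G)"])
  show "{A} \<notin> edges (token_graph k G)" for A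
    by (auto simp: token_graph_def Let_def)
qed

lemma token_graph_neighbourE:
  assumes A_vertex: "A \<in> verts (token_graph k G)" and B_vertex: "B \<in> verts (token_graph k G)"
    and adjacent: "{A, B} \<in> edges (token_graph k G)"
  obtains i j where "i \<in> A" "j \<in> verts G - A" "{i, j} \<in> edges G" "B = insert j (A - {i})"
proof -
  obtain a b where edge: "{a, b} \<in> edges G" "sym_diff A B = {a, b}"
    using adjacent edges_token_graph_iff[OF A_vertex B_vertex] by blast
  have "a \<noteq> b" using edge no_loops by auto
  have finite: "finite A" "finite B" "card A = card B"
    using A_vertex B_vertex by (auto simp: verts_token_graph)
  then have "card (A - B) = card (B - A)" by (simp add: card_Diff_subset_Int Int_commute)
  moreover have "card (A - B) + card (B - A) = 2"
    using finite edge(2) \<open>a \<noteq> b\<close> by (subst card_Un_disjoint[symmetric]) auto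
  ultimately have "card (A - B) = 1" "card (B - A) = 1" by auto
  then obtain i j where diffs: "A - B = {i}" "B - A = {j}" by (metis card_1_singletonE)
  then have "{i, j} = {a, b}" using edge(2) by auto
  show thesis
  proof
    show "i \<in> A" "j \<in> verts G - A" using diffs B_vertex by (auto simp: verts_token_graph)
    show "{i, j} \<in> edges G" using \<open>{i, j} = {a, b}\<close> edge(1) by simp
    show "B = insert j (A - {i})" using diffs by blast
  qed
qed

lemma token_move_adjacent:
  assumes A_vertex: "A \<in> verts (token_graph k G)"
    and move: "i \<in> A" "j \<in> verts G - A" "{i, j} \<in> edges G"
  shows "insert j (A - {i}) \<in> verts (token_graph k G)"
    "{A, insert j (A - {i})} \<in> edges (token_graph k G)"
proof -
  have "card A > 0" using A_vertex move by (auto simp: verts_token_graph card_gt_0_iff)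
  then show moved_vertex: "insert j (A - {i}) \<in> verts (token_graph k G)"
    using A_vertex move by (auto simp: verts_token_graph)
  have "sym_diff A (insert j (A - {i})) = {i, j}" using move by auto
  then show "{A, insert j (A - {i})} \<in> edges (token_graph k G)"
    using move edges_token_graph_iff[OF A_vertex moved_vertex] by blast
qed

lemma bij_betw_token_moves:
  assumes A_vertex: "A \<in> verts (token_graph k G)"
  shows "bij_betw (\<lambda>(i, j). insert j (A - {i})) (SIGMA i:A. {j \<in> verts G - A. {i, j} \<in> edges G})
    {B. B \<in> verts (token_graph k G) \<and> {A, B} \<in> edges (token_graph k G)}"
proof (rule bij_betw_imageI)
  show "inj_on (\<lambda>(i, j). insert j (A - {i})) (SIGMA i:A. {j \<in> verts G - A. {i, j} \<in> edges G})"
  proof (rule inj_onI, clarify)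
    fix i j i' j'
    assume moves: "i \<in> A" "i' \<in> A" "j \<notin> A" "j' \<notin> A" "insert j (A - {i}) = insert j' (A - {i'})"
    then have "j = j'" by blast
    moreover have "i \<notin> insert j (A - {i})" using moves by blast
    then have "i = i'" using moves by simp
    ultimately show "i = i' \<and> j = j'" by simp
  qed
next
  show "(\<lambda>(i, j). insert j (A - {i})) ` (SIGMA i:A. {j \<in> verts G - A. {i, j} \<in> edges G}) =
    {B. B \<in> verts (token_graph k G) \<and> {A, B} \<in> edges (token_graph k G)}" (is "?f ` ?M = ?N")
  proof (intro equalityI subsetI)
    fix B assume "B \<in> ?f ` ?M"
    then show "B \<in> ?N" using token_move_adjacent[OF A_vertex] by auto
  next
    fix B assume "B \<in> ?N"
    then obtain i j where "i \<in> A" "j \<in> verts G - A" "{i, j} \<in> edges G" "B = insert j (A - {i})"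
      using token_graph_neighbourE[OF A_vertex] by blast
    then show "B \<in> ?f ` ?M" by (intro image_eqI[of _ _ "(i, j)"]) auto
  qed
qed

lemma graph_laplacian_token_graph:
  assumes A_vertex: "A \<in> verts (token_graph k G)"
  shows "graph_laplacian (token_graph k G) (\<lambda>B. \<Sum>i\<in>B. y i) A = (\<Sum>i\<in>A. graph_laplacian G y i)"
proof -
  let ?M = "SIGMA i:A. {j \<in> verts G - A. {i, j} \<in> edges G}"
  have "A \<subseteq> verts G" "finite A" using A_vertex by (auto simp: verts_token_graph)
  have "graph_laplacian (token_graph k G) (\<lambda>B. \<Sum>i\<in>B. y i) A =
      (\<Sum>(i, j)\<in>?M. (\<Sum>l\<in>A. y l) - (\<Sum>l\<in>insert j (A - {i}). y l))"
    unfolding graph_laplacian_def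
    by (subst sum.reindex_bij_betw[OF bij_betw_token_moves[OF A_vertex], symmetric])
      (simp add: case_prod_unfold)
  also have "\<dots> = (\<Sum>(i, j)\<in>?M. y i - y j)"
    using \<open>finite A\<close> by (intro sum.cong) (auto simp: sum.remove)
  also have "\<dots> = (\<Sum>i\<in>A. \<Sum>j | j \<in> verts G - A \<and> {i, j} \<in> edges G. y i - y j)"
    using \<open>finite A\<close> finite_verts by (subst sum.Sigma) auto
  also have "\<dots> = (\<Sum>i\<in>A. graph_laplacian G y i - graph_laplacian (A, edges G) y i)"
  proof (intro sum.cong refl)
    fix i
    have "{j. j \<in> verts G \<and> {i, j} \<in> edges G} =
        {j. j \<in> verts G - A \<and> {i, j} \<in> edges G} \<union> {j. j \<in> A \<and> {i, j} \<in> edges G}"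
      using \<open>A \<subseteq> verts G\<close> by auto
    then show "(\<Sum>j | j \<in> verts G - A \<and> {i, j} \<in> edges G. y i - y j) =
        graph_laplacian G y i - graph_laplacian (A, edges G) y i"
      using finite_verts \<open>finite A\<close> unfolding graph_laplacian_def
      by (simp, subst sum.union_disjoint) auto
  qed
  \<comment> \<open>The differences between two tokens cancel in pairs.\<close>
  also have "\<dots> = (\<Sum>i\<in>A. graph_laplacian G y i)"
    using sum_graph_laplacian[of "(A, edges G)" y] \<open>finite A\<close> by (simp add: sum_subtractf)
  finally show ?thesis .
qed

end

lemma exists_subset_sum_nonzero:
  fixes y :: "'a \<Rightarrow> 'b :: {idom, ring_char_0}"
  assumes "finite V" "1 \<le> k" "k < card V" "w \<in> V" "y w \<noteq> 0"
  shows "\<exists>A\<subseteq>V. card A = k \<and> (\<Sum>i\<in>A. y i) \<noteq> 0"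
proof (cases "\<exists>v\<in>V. y v \<noteq> y w")
  case True
  then obtain v where v_props: "v \<in> V" "y v \<noteq> y w" by blast
  then have "v \<noteq> w" by auto
  then have "k - 1 \<le> card (V - {v, w})" using v_props assms by (subst card_Diff_subset) auto
  then obtain B where B_props: "B \<subseteq> V - {v, w}" "card B = k - 1" "finite B"
    by (metis obtain_subset_with_card_n)
  then have "v \<notin> B" "w \<notin> B" by auto
  then have "(\<Sum>i\<in>insert v B. y i) \<noteq> (\<Sum>i\<in>insert w B. y i)" using B_props v_props by simp
  moreover have "insert v B \<subseteq> V" "insert w B \<subseteq> V" "card (insert v B) = k" "card (insert w B) = k"
    using B_props v_props assms \<open>v \<notin> B\<close> \<open>w \<notin> B\<close> by auto
  ultimately show ?thesis by metis
next
  case False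
  obtain A where A_props: "A \<subseteq> V" "card A = k"
    using assms by (metis less_imp_le obtain_subset_with_card_n)
  then have "(\<Sum>i\<in>A. y i) = (\<Sum>i\<in>A. y w)" using False by (intro sum.cong) auto
  then have "(\<Sum>i\<in>A. y i) \<noteq> 0" using A_props assms by simp
  then show ?thesis using A_props by blast
qed

lemma (in simple_graph) laplacian_eigenfunction_token_graph:
  assumes eigen: "laplacian_eigenfunction G \<mu> y" and k_bounds: "1 \<le> k" "k < card (verts G)"
  shows "laplacian_eigenfunction (token_graph k G) \<mu> (\<lambda>A. \<Sum>i\<in>A. y i)"
  unfolding laplacian_eigenfunction_def
proof
  have lap: "graph_laplacian G y i = \<mu> * y i" if "i \<in> verts G" for i
    using eigen that by (simp add: laplacian_eigenfunction_def)
  show "\<forall>A\<in>verts (token_graph k G).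
      graph_laplacian (token_graph k G) (\<lambda>A. \<Sum>i\<in>A. y i) A = \<mu> * (\<Sum>i\<in>A. y i)"
    using lap
    by (auto simp: graph_laplacian_token_graph sum_distrib_left verts_token_graph intro!: sum.cong)
  obtain w where "w \<in> verts G" "y w \<noteq> 0" using eigen by (auto simp: laplacian_eigenfunction_def)
  then obtain A where "A \<subseteq> verts G" "card A = k" "(\<Sum>i\<in>A. y i) \<noteq> 0"
    using exists_subset_sum_nonzero[OF finite_verts k_bounds] by blast
  then show "\<exists>A\<in>verts (token_graph k G). (\<Sum>i\<in>A. y i) \<noteq> 0"
    using finite_subset[OF _ finite_verts] by (auto simp: verts_token_graph)
qed

section \<open>The two-token graph of a cycle\<close>

lemma sum_doubletons:
  fixes \<psi> :: "'a set \<Rightarrow> 'b :: comm_semiring_1"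
  assumes "finite V"
  shows "(\<Sum>a\<in>V. \<Sum>b\<in>V - {a}. \<psi> {a, b}) = 2 * (\<Sum>A | A \<subseteq> V \<and> card A = 2. \<psi> A)"
proof -
  define W where "W = {A. A \<subseteq> V \<and> card A = 2}"
  have "finite W" using assms by (auto simp: W_def intro: finite_subset[of _ "Pow V"])
  have pairs: "(\<Sum>b\<in>V - {a}. \<psi> {a, b}) = (\<Sum>A | A \<in> W \<and> a \<in> A. \<psi> A)" if "a \<in> V" for a
  proof (rule sum.reindex_bij_betw)
    have "\<exists>b\<in>V - {a}. A = {a, b}" if "A \<in> W" "a \<in> A" for A
      using that by (auto simp: W_def card_2_iff)
    then show "bij_betw (\<lambda>b. {a, b}) (V - {a}) {A. A \<in> W \<and> a \<in> A}"
      using \<open>a \<in> V\<close> by (auto simp: bij_betw_def inj_on_def doubleton_eq_iff W_def image_iff)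
  qed
  have "(\<Sum>a\<in>V. \<Sum>b\<in>V - {a}. \<psi> {a, b}) = (\<Sum>a\<in>V. \<Sum>A | A \<in> W \<and> a \<in> A. \<psi> A)"
    by (simp add: pairs)
  also have "\<dots> = (\<Sum>A\<in>W. \<Sum>a | a \<in> V \<and> a \<in> A. \<psi> A)"
    by (rule sum.swap_restrict[OF assms \<open>finite W\<close>])
  also have "\<dots> = (\<Sum>A\<in>W. 2 * \<psi> A)"
  proof (rule sum.cong)
    fix A assume "A \<in> W"
    then have "{a. a \<in> V \<and> a \<in> A} = A" "card A = 2" by (auto simp: W_def)
    then show "(\<Sum>a | a \<in> V \<and> a \<in> A. \<psi> A) = 2 * \<psi> A" by simp
  qed simp
  finally show ?thesis by (simp add: W_def sum_distrib_left)
qed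

lemma sum_cyclic_distance:
  fixes n a :: nat
  assumes "a < n"
  shows "(\<Sum>d\<in>{1..<n}. \<phi> ((a + d) mod n)) = (\<Sum>b\<in>{..<n} - {a}. \<phi> b)"
proof (rule sum.reindex_bij_betw, unfold bij_betw_def, intro conjI)
  show inj: "inj_on (\<lambda>d. (a + d) mod n) {1..<n}"
    by (rule inj_onI) (simp add: add_mod_cancel_left)
  have "(\<lambda>d. (a + d) mod n) ` {1..<n} \<subseteq> {..<n} - {a}"
    using assms add_mod_cancel_left[of _ n 0 a] by fastforce
  then show "(\<lambda>d. (a + d) mod n) ` {1..<n} = {..<n} - {a}"
    using assms card_image[OF inj] by (intro card_subset_eq) auto
qed

lemma sum_pairs_cyclic_distance:
  fixes \<psi> :: "nat set \<Rightarrow> 'b :: comm_semiring_1"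
  shows "(\<Sum>a<n. \<Sum>d\<in>{1..<n}. \<psi> {a, (a + d) mod n}) = 2 * (\<Sum>A | A \<subseteq> {..<n} \<and> card A = 2. \<psi> A)"
proof -
  have "(\<Sum>d\<in>{1..<n}. \<psi> {a, (a + d) mod n}) = (\<Sum>b\<in>{..<n} - {a}. \<psi> {a, b})" if "a < n" for a
    using that by (rule sum_cyclic_distance)
  then show ?thesis by (simp flip: sum_doubletons)
qed

lemma cyclic_distances_distinct:
  fixes a d n :: nat
  assumes "a < n" "1 \<le> d" "d + 1 < n"
  shows "a \<noteq> (a + d) mod n" "a \<noteq> (a + (d + 1)) mod n" "(a + d) mod n \<noteq> (a + (d + 1)) mod n"
  using assms add_mod_cancel_left[of d n 0 a] add_mod_cancel_left[of "d + 1" n 0 a]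
    add_mod_cancel_left[of d n "d + 1" a] by auto

lemma adjacent_pairs_eq_iff:
  assumes "a \<noteq> b" "a \<noteq> c" "b \<noteq> c" "a' \<noteq> b'" "a' \<noteq> c'" "b' \<noteq> c'"
  shows "{{a, b}, {a, c}} = {{a', b'}, {a', c'}} \<longleftrightarrow> a = a' \<and> {b, c} = {b', c'}"
  using assms by (auto simp: doubleton_eq_iff)

lemma inj_on_cyclic_pair_move:
  fixes n :: nat
  assumes n_ge_3: "3 \<le> n"
  shows "inj_on (\<lambda>(a, d). {{a, (a + d) mod n}, {a, (a + (d + 1)) mod n}}) ({..<n} \<times> {1..<n-1})"
proof (rule inj_onI; elim SigmaE; simp only: prod.case prod.inject)
  fix a d a' d' assume "a \<in> {..<n}" "d \<in> {1..<n-1}" "a' \<in> {..<n}" "d' \<in> {1..<n-1}"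
  then have bounds: "a < n" "1 \<le> d" "d + 1 < n" "a' < n" "1 \<le> d'" "d' + 1 < n" by auto
  assume "{{a, (a + d) mod n}, {a, (a + (d + 1)) mod n}} =
    {{a', (a' + d') mod n}, {a', (a' + (d' + 1)) mod n}}"
  then have same_fixed: "a = a'"
    and "{(a + d) mod n, (a + (d + 1)) mod n} =
    {(a' + d') mod n, (a' + (d' + 1)) mod n}"
    unfolding adjacent_pairs_eq_iff[OF cyclic_distances_distinct[OF bounds(1-3)]
        cyclic_distances_distinct[OF bounds(4-6)]] by blast+
  moreover have "(b + (e + 1)) mod n = ((b + e) mod n + 1) mod n" for b e by (simp add: mod_simps)
  ultimately have "(a + d) mod n = (a' + d') mod n"
    using n_ge_3 by (intro inj_onD[OF inj_on_cycle_edge[OF n_ge_3]]) auto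
  then show "a = a' \<and> d = d'" using same_fixed bounds add_mod_cancel_left[of d n d' a] by auto
qed

context simple_graph
begin

lemma token_graph_2_adjacent:
  assumes "a \<in> verts G" "b \<in> verts G" "c \<in> verts G" "{b, c} \<in> edges G" "a \<noteq> b" "a \<noteq> c"
  shows "{a, b} \<in> verts (token_graph 2 G) \<and> {a, c} \<in> verts (token_graph 2 G) \<and>
    {{a, b}, {a, c}} \<in> edges (token_graph 2 G)"
proof -
  have "{a, b} \<in> verts (token_graph 2 G)" using assms by (auto simp: verts_token_graph)
  moreover have "insert c ({a, b} - {b}) = {a, c}" "c \<noteq> b" using assms no_loops by auto
  ultimately show ?thesis using token_move_adjacent[of "{a, b}" 2 b c] assms by auto
qed

lemma one_token_poincare:
  assumes n_ge_3: "3 \<le> n" and bij: "bij_betw e {..<n} (verts G)"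
    and cycle: "\<And>i. i < n \<Longrightarrow> {e i, e ((i + 1) mod n)} \<in> edges G"
  shows "poincare_inequality (token_graph 1 G) (cycle_gap n)"
proof (rule simple_graph.hamiltonian_cycle_poincare[OF simple_graph_token_graph n_ge_3])
  have verts: "verts (token_graph 1 G) = (\<lambda>u. {u}) ` verts G"
    by (auto simp: verts_token_graph card_1_singleton_iff)
  then show "bij_betw (\<lambda>i. {e i}) {..<n} (verts (token_graph 1 G))"
    using bij by (auto simp: bij_betw_def inj_on_def image_image)
  show "{{e i}, {e ((i + 1) mod n)}} \<in> edges (token_graph 1 G)" if "i < n" for i
  proof -
    have "e i \<in> verts G" "e ((i + 1) mod n) \<in> verts G"
      using bij that n_ge_3 by (auto simp: bij_betw_def)
    moreover have "e ((i + 1) mod n) \<noteq> e i" using cycle[OF that] no_loops[of "e i"] by auto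
    moreover have "{e i} \<in> verts (token_graph 1 G)" using \<open>e i \<in> verts G\<close> verts by simp
    ultimately show ?thesis
      using token_move_adjacent(2)[of "{e i}" 1 "e i" "e ((i + 1) mod n)"] cycle[OF that] by simp
  qed
qed

end

lemma sum_cyclic_pair_moves_le_dirichlet_form:
  fixes G :: "nat graph"
  assumes n_ge_3: "3 \<le> n" and "simple_graph G" and verts_G: "verts G = {..<n}"
    and cycle: "\<And>i. i < n \<Longrightarrow> {i, (i + 1) mod n} \<in> edges G"
  shows "(\<Sum>a<n. \<Sum>d\<in>{1..<n-1}. (f {a, (a + d) mod n} - f {a, (a + (d + 1)) mod n})\<^sup>2) \<le>
    dirichlet_form (token_graph 2 G) f"
proof -
  interpret simple_graph G by fact
  interpret token: simple_graph "token_graph 2 G" by (rule simple_graph_token_graph)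
  have edge: "{a, (a + d) mod n} \<in> verts (token_graph 2 G) \<and>
      {a, (a + (d + 1)) mod n} \<in> verts (token_graph 2 G) \<and>
      {{a, (a + d) mod n}, {a, (a + (d + 1)) mod n}} \<in> edges (token_graph 2 G)"
    if "a < n" "1 \<le> d" "d + 1 < n" for a d
  proof (rule token_graph_2_adjacent)
    show "{(a + d) mod n, (a + (d + 1)) mod n} \<in> edges G"
      using cycle[of "(a + d) mod n"] n_ge_3 by (simp add: mod_simps)
  qed (use cyclic_distances_distinct[OF that] that verts_G in auto)
  have "(\<Sum>a<n. \<Sum>d\<in>{1..<n-1}. (f {a, (a + d) mod n} - f {a, (a + (d + 1)) mod n})\<^sup>2) =
      (\<Sum>i\<in>{..<n} \<times> {1..<n-1}. (f (case i of (a, d) \<Rightarrow> {a, (a + d) mod n}) -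
        f (case i of (a, d) \<Rightarrow> {a, (a + (d + 1)) mod n}))\<^sup>2)"
    by (simp add: sum.cartesian_product case_prod_unfold)
  also have "\<dots> \<le> dirichlet_form (token_graph 2 G) f"
    using inj_on_cyclic_pair_move[OF n_ge_3] edge
    by (intro token.sum_edges_le_dirichlet_form) (auto simp: case_prod_unfold)
  finally show ?thesis .
qed

theorem two_token_poincare:
  assumes n_ge_3: "3 \<le> n" and simple: "simple_graph G" and verts_G: "verts G = {..<n}"
    and cycle: "\<And>i. i < n \<Longrightarrow> {i, (i + 1) mod n} \<in> edges G"
  shows "poincare_inequality (token_graph 2 G) (cycle_gap n)"
  unfolding poincare_inequality_def
proof (intro allI impI)
  let ?T = "token_graph 2 G"
  fix f :: "nat set \<Rightarrow> real" assume sum0: "(\<Sum>A\<in>verts ?T. f A) = 0"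
  define h where "h a d = complex_of_real (f {a mod n, (a + d) mod n})" for a d
  have verts: "verts ?T = {A. A \<subseteq> {..<n} \<and> card A = 2}"
    using verts_G finite_subset[of _ "{..<n}"] by (auto simp: verts_token_graph)
  have sum_h: "(\<Sum>a<n. \<Sum>d\<in>{1..<n}. \<phi> (h a d)) = 2 * (\<Sum>A\<in>verts ?T. \<phi> (of_real (f A)))"
    for \<phi> :: "complex \<Rightarrow> 'b :: comm_semiring_1"
    using sum_pairs_cyclic_distance[of "\<lambda>A. \<phi> (of_real (f A))" n] by (simp add: verts h_def)
  have "cycle_gap n * (\<Sum>a<n. \<Sum>d\<in>{1..<n}. (cmod (h a d))\<^sup>2) \<le>
    2 * (\<Sum>a<n. \<Sum>d\<in>{1..<n-1}. (cmod (h a d - h a (d + 1)))\<^sup>2)"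
  proof (rule pair_poincare[OF n_ge_3])
    show "h (a + n) d = h a d" for a d
      using mod_add_self2[of "a + d" n] by (simp add: h_def add.commute add.left_commute)
    show "h (a + d) (n - d) = h a d" if "1 \<le> d" "d < n" for a d
      using that by (simp add: h_def insert_commute)
    show "(\<Sum>a<n. \<Sum>d\<in>{1..<n}. h a d) = 0"
      using sum_h[of "\<lambda>z. z"] sum0 by (simp flip: of_real_sum)
  qed
  also have "(\<Sum>a<n. \<Sum>d\<in>{1..<n-1}. (cmod (h a d - h a (d + 1)))\<^sup>2) =
      (\<Sum>a<n. \<Sum>d\<in>{1..<n-1}. (f {a, (a + d) mod n} - f {a, (a + (d + 1)) mod n})\<^sup>2)"
    by (intro sum.cong refl) (simp add: h_def flip: of_real_diff)
  also have "\<dots> \<le> dirichlet_form ?T f"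
    by (rule sum_cyclic_pair_moves_le_dirichlet_form[OF n_ge_3 simple verts_G cycle])
  finally show "cycle_gap n * (\<Sum>A\<in>verts ?T. (f A)\<^sup>2) \<le> dirichlet_form ?T f"
    using sum_h[of "\<lambda>z. (cmod z)\<^sup>2"] by (simp add: mult.left_commute)
qed

section \<open>Reflection-symmetric waves on a cycle with chords\<close>

lemma verts_add_edges [simp]: "verts (add_edges G S) = verts G"
  by (simp add: add_edges_def)

lemma edges_add_edges [simp]: "edges (add_edges G S) = edges G \<union> S"
  by (simp add: add_edges_def)

lemma verts_cycle_graph [simp]: "verts (cycle_graph n) = {..<n}"
  by (simp add: cycle_graph_def)

lemma graph_laplacian_add_edges:
  assumes "finite (verts G)" and "\<And>u v. {u, v} \<in> S \<Longrightarrow> f u = f v"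
  shows "graph_laplacian (add_edges G S) f u = graph_laplacian G f u"
  unfolding graph_laplacian_def using assms by (intro sum.mono_neutral_right) auto

lemma edges_cycle_graph_iff:
  assumes "i < n" "j < n"
  shows "{i, j} \<in> edges (cycle_graph n) \<longleftrightarrow> j = (i + 1) mod n \<or> j = (i + (n - 1)) mod n"
proof -
  have "((j + 1) mod n + (n - 1)) mod n = j" "((i + (n - 1)) mod n + 1) mod n = i"
    using assms
    by (simp_all only: mod_add_left_eq add.assoc le_add_diff_inverse le_add_diff_inverse2) simp_all
  then have "i = (j + 1) mod n \<longleftrightarrow> j = (i + (n - 1)) mod n" by auto
  moreover have "{i, j} \<in> edges (cycle_graph n) \<longleftrightarrow> j = (i + 1) mod n \<or> i = (j + 1) mod n"
    using assms by (auto simp: cycle_graph_def doubleton_eq_iff)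
  ultimately show ?thesis by simp
qed

lemma graph_laplacian_cycle_graph:
  assumes "3 \<le> n" "i < n"
  shows "graph_laplacian (cycle_graph n) f i =
    2 * f i - f ((i + 1) mod n) - f ((i + (n - 1)) mod n)"
proof -
  have "{j. j \<in> verts (cycle_graph n) \<and> {i, j} \<in> edges (cycle_graph n)} =
      {(i + 1) mod n, (i + (n - 1)) mod n}"
    using assms edges_cycle_graph_iff[of i n] by auto
  moreover have "(i + 1) mod n \<noteq> (i + (n - 1)) mod n"
    using assms add_mod_cancel_left[of 1 n "n - 1" i] by simp
  ultimately show ?thesis by (simp add: graph_laplacian_def)
qed

lemma simple_graph_cycle_with_chords:
  assumes n_ge_3: "3 \<le> n" and chords: "S \<subseteq> sum_edges n \<nu>"
  shows "simple_graph (add_edges (cycle_graph n) S)"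
proof
  show "{i} \<notin> edges (add_edges (cycle_graph n) S)" for i
  proof
    assume "{i} \<in> edges (add_edges (cycle_graph n) S)"
    moreover have "{i} \<notin> sum_edges n \<nu>" by (auto simp: sum_edges_def)
    ultimately obtain j where "j < n" "j = (j + 1) mod n"
      using chords by (auto simp: cycle_graph_def)
    then show False using n_ge_3 add_mod_cancel_left[of 0 n 1 j] by simp
  qed
qed simp

definition cycle_wave :: "nat \<Rightarrow> real \<Rightarrow> nat \<Rightarrow> real" where
  "cycle_wave n \<phi> i = cos (2 * pi * real i / real n - \<phi>)"

lemma cycle_wave_mod:
  assumes "0 < n"
  shows "cycle_wave n \<phi> (i mod n) = cycle_wave n \<phi> i"
proof -
  have "real i = real n * real (i div n) + real (i mod n)"
    by (metis mult_div_mod_eq of_nat_add of_nat_mult)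
  then have "2 * pi * real i / real n - \<phi> =
      (2 * pi * real (i mod n) / real n - \<phi>) + 2 * real (i div n) * pi"
    using assms by (simp add: field_simps)
  then have "cycle_wave n \<phi> i =
      cos ((2 * pi * real (i mod n) / real n - \<phi>) + 2 * real (i div n) * pi)"
    by (simp only: cycle_wave_def)
  also have "\<dots> = cycle_wave n \<phi> (i mod n)" by (simp only: cos_add cos_2npi sin_2npi cycle_wave_def)
  finally show ?thesis ..
qed

lemma cycle_wave_add:
  "cycle_wave n \<phi> (i + j) = cos (2 * pi * real i / real n - \<phi> + 2 * pi * real j / real n)"
  by (simp add: cycle_wave_def add_divide_distrib distrib_left algebra_simps)

lemma cycle_wave_0_or_1_nonzero:
  assumes "3 \<le> n"
  shows "cycle_wave n \<phi> 0 \<noteq> 0 \<or> cycle_wave n \<phi> 1 \<noteq> 0"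
proof (rule ccontr)
  let ?t = "2 * pi / real n"
  assume "\<not> ?thesis"
  then have "cos \<phi> = 0" "sin ?t * sin \<phi> = 0" by (auto simp: cycle_wave_def cos_diff)
  moreover have "0 < sin ?t" using assms by (intro sin_gt_zero) (auto simp: field_simps)
  ultimately show False using sin_cos_squared_add[of \<phi>] by simp
qed

lemma laplacian_eigenfunction_cycle_wave:
  assumes n_ge_3: "3 \<le> n"
  shows "laplacian_eigenfunction (cycle_graph n) (cycle_gap n) (cycle_wave n \<phi>)"
  unfolding laplacian_eigenfunction_def
proof
  let ?t = "2 * pi / real n"
  show "\<forall>i\<in>verts (cycle_graph n).
      graph_laplacian (cycle_graph n) (cycle_wave n \<phi>) i = cycle_gap n * cycle_wave n \<phi> i"
  proof
    fix i assume "i \<in> verts (cycle_graph n)"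
    define x where "x = 2 * pi * real i / real n - \<phi>"
    have wave: "cycle_wave n \<phi> i = cos x" by (simp add: cycle_wave_def x_def)
    have "cycle_wave n \<phi> (i + 1) = cos (x + ?t)"
      using cycle_wave_add[of n \<phi> i 1] by (simp add: x_def)
    moreover have "cycle_wave n \<phi> (i + (n - 1)) = cos (x - ?t)"
    proof -
      have step: "2 * pi * real (n - 1) / real n = 2 * pi - ?t"
        using n_ge_3 by (simp add: of_nat_diff field_simps)
      have "cycle_wave n \<phi> (i + (n - 1)) = cos (x - ?t + 2 * pi)"
        unfolding cycle_wave_add step x_def by (rule arg_cong[of _ _ cos]) simp
      then show ?thesis by simp
    qed
    ultimately have "graph_laplacian (cycle_graph n) (cycle_wave n \<phi>) i =
        2 * cos x - cos (x + ?t) - cos (x - ?t)"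
      using n_ge_3 \<open>i \<in> _\<close> graph_laplacian_cycle_graph[OF n_ge_3, of i]
      by (simp add: cycle_wave_mod wave del: One_nat_def)
    also have "\<dots> = cycle_gap n * cycle_wave n \<phi> i"
      by (simp add: cycle_gap_def wave cos_add cos_diff algebra_simps)
    finally show "graph_laplacian (cycle_graph n) (cycle_wave n \<phi>) i =
        cycle_gap n * cycle_wave n \<phi> i" .
  qed
  show "\<exists>i\<in>verts (cycle_graph n). cycle_wave n \<phi> i \<noteq> 0"
    using n_ge_3 cycle_wave_0_or_1_nonzero[OF n_ge_3, of \<phi>] by force
qed

lemma laplacian_eigenfunction_cycle_with_chords:
  assumes n_ge_3: "3 \<le> n" and chords: "S \<subseteq> sum_edges n \<nu>"
  shows "laplacian_eigenfunction (add_edges (cycle_graph n) S) (cycle_gap n)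
    (cycle_wave n (pi * real \<nu> / real n))"
proof -
  let ?y = "cycle_wave n (pi * real \<nu> / real n)"
  have "?y i = ?y j" if "{i, j} \<in> S" for i j
  proof -
    have "{i, j} \<in> sum_edges n \<nu>" using that chords by blast
    then have "i + j = \<nu>" by (auto simp: sum_edges_def doubleton_eq_iff)
    then have "2 * pi * real j / real n - pi * real \<nu> / real n =
        - (2 * pi * real i / real n - pi * real \<nu> / real n)"
      by (auto simp: algebra_simps add_divide_distrib)
    then show ?thesis unfolding cycle_wave_def by (simp only: cos_minus)
  qed
  then have "graph_laplacian (add_edges (cycle_graph n) S) ?y i =
      graph_laplacian (cycle_graph n) ?y i" for i
    by (intro graph_laplacian_add_edges) auto
  then show ?thesis
    using laplacian_eigenfunction_cycle_wave[OF n_ge_3] by (simp add: laplacian_eigenfunction_def)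
qed

lemma (in simple_graph) algebraic_connectivity_token_graph_eqI:
  assumes "1 \<le> k" "k < card (verts G)" and "0 < l" and eigen: "laplacian_eigenfunction G l y"
    and poincare: "poincare_inequality (token_graph k G) l"
  shows "algebraic_connectivity (token_graph k G) = l"
proof -
  interpret token: simple_graph "token_graph k G" by (rule simple_graph_token_graph)
  show ?thesis
    using \<open>0 < l\<close> poincare laplacian_eigenfunction_token_graph[OF eigen assms(1,2)]
    by (rule token.algebraic_connectivity_eqI)
qed

theorem theorem3p7:
  fixes n \<nu> k :: nat and S :: "nat set set" and G :: "nat graph"
  assumes "n \<ge> 3"
    and "odd n \<Longrightarrow> \<nu> = n"
    and "even n \<Longrightarrow> \<nu> \<in> {n, n - 1}"
    and "S \<subseteq> sum_edges n \<nu>"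
    and "G = add_edges (cycle_graph n) S"
    and "k \<in> {1, 2}"
  shows "algebraic_connectivity (token_graph k G) = algebraic_connectivity G"
proof -
  note n_ge_3 = \<open>n \<ge> 3\<close>
  interpret simple_graph G
    unfolding \<open>G = _\<close> using n_ge_3 \<open>S \<subseteq> _\<close> by (rule simple_graph_cycle_with_chords)
  have verts_G: "verts G = {..<n}" and bij: "bij_betw (\<lambda>i. i) {..<n} (verts G)"
    by (simp_all add: \<open>G = _\<close> bij_betw_def)
  have cycle: "{i, (i + 1) mod n} \<in> edges G" if "i < n" for i
    using that by (auto simp: \<open>G = _\<close> cycle_graph_def)
  have gap: "0 < cycle_gap n" using n_ge_3 by (intro cycle_gap_pos) simp
  obtain y where eigen: "laplacian_eigenfunction G (cycle_gap n) y"
    using laplacian_eigenfunction_cycle_with_chords[OF n_ge_3 \<open>S \<subseteq> _\<close>] \<open>G = _\<close> by blast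
  have k_bounds: "1 \<le> k" "k < card (verts G)" using \<open>k \<in> _\<close> n_ge_3 by (auto simp: verts_G)
  have "poincare_inequality (token_graph 1 G) (cycle_gap n)"
    by (rule one_token_poincare[OF n_ge_3 bij cycle])
  moreover have "poincare_inequality (token_graph 2 G) (cycle_gap n)"
    by (rule two_token_poincare[OF n_ge_3 simple_graph_axioms verts_G cycle])
  ultimately have "poincare_inequality (token_graph k G) (cycle_gap n)"
    using \<open>k \<in> _\<close> by (elim insertE emptyE) simp_all
  with k_bounds gap eigen have "algebraic_connectivity (token_graph k G) = cycle_gap n"
    by (rule algebraic_connectivity_token_graph_eqI)
  also have "cycle_gap n = algebraic_connectivity G"
    using gap hamiltonian_cycle_poincare[OF n_ge_3 bij cycle] eigen
    by (rule algebraic_connectivity_eqI[symmetric])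
  finally show ?thesis .
qed

end
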